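(* Let $P:\mathbb C^{\mathrm{op}}\to\mathbf{Pos}$ be a primary doctrine, $X$ an object of $\mathbb C$ and $\varphi\in P(X)$. For every primary doctrine $R$, the functor $\mathbf{PD}(P_{(X,\varphi)},R)\to\mathbf{PD}_{(X,\varphi)}(P,R)$ induced by precomposition with $(F_X,\mathfrak f):P\to P_{(X,\varphi)}$, which sends a 2-cell $\xi:(K,\mathfrak k)\to(K',\mathfrak k')$ to $\xi_{F_X}:\big((K,\mathfrak k)\circ(F_X,\mathfrak f),K(\mathrm{id}_X)\big)\to\big((K',\mathfrak k')\circ(F_X,\mathfrak f),K'(\mathrm{id}_X)\big)$, is an equivalence of categories.
   Context: A doctrine is a functor $P:\mathbb C^{\mathrm{op}}\to\mathbf{Pos}$ with $\mathbb C$ a category with finite products and $\mathbf{Pos}$ the category of posets and monotone maps; the maps $P(f)$ are called reindexings. It is primary if every $P(A)$ has finite meets ($\wedge$, $\top$) and all reindexings preserve them. A 1-arrow (doctrine homomorphism) from $P:\mathbb C^{\mathrm{op}}\to\mathbf{Pos}$ to $R:\mathbb D^{\mathrm{op}}\to\mathbf{Pos}$ is a pair $(F,\mathfrak f)$ with $F:\mathbb C\to\mathbb D$ a finite-product-preserving functor and $\mathfrak f:P\to R\circ F^{\mathrm{op}}$ natural; it is primary if $P,R$ are primary and each $\mathfrak f_A$ preserves finite meets. Composition: $(G,\mathfrak g)\circ(F,\mathfrak f)=(GF,(\mathfrak g_{FA}\mathfrak f_A)_A)$. A 2-cell $(F,\mathfrak f)\to(G,\mathfrak g):P\to R$ is a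 natural transformation $\theta:F\to G$ with $\mathfrak f_A(\alpha)\le R(\theta_A)(\mathfrak g_A(\alpha))$ for all $A$ and $\alpha\in P(A)$. $\mathbf{PD}$ is the 2-category of primary doctrines, primary 1-arrows and all 2-cells between them. Kleisli doctrine. Given a primary doctrine $P:\mathbb C^{\mathrm{op}}\to\mathbf{Pos}$, an object $X$ of $\mathbb C$ and $\varphi\in P(X)$: the category $\mathbb C_X$ has the same objects as $\mathbb C$; an arrow $g:A\rightsquigarrow B$ in $\mathbb C_X$ is a $\mathbb C$-arrow $g:X\times A\to B$; the identity of $A$ is $\mathrm{pr}_2:X\times A\to A$; the composite of $g:A\rightsquigarrow B$ and $h:B\rightsquigarrow C$ is $h\langle\mathrm{pr}_1,g\rangle$. It has finite products, given on objects by those of $\mathbb C$. The doctrine $P_{(X,\varphi)}:\mathbb C_X^{\mathrm{op}}\to\mathbf{Pos}$ has $P_{(X,\varphi)}(A)=\{\alpha\in P(X\times A)\mid\alpha\le P(\mathrm{pr}_1)(\varphi)\}$ with the order of $P(X\times A)$, and reindexing along $g:A\rightsquigarrow B$ is the restriction of $P(\langle\mathrm{pr}_1,g\rangle)$. The 1-arrow $(F_X,\mathfrak f):P\to P_{(X,\varphi)}$: $F_X:\mathbb C\to\mathbb C_X$ is the identity on objects and sends $f:A\to B$ to $f\,\mathrm{pr}_2:A\rightsquigarrow B$; $\mathfrak f_A(\alpha)=P(\mathrm{pr}_1)(\varphi)\wedge P(\mathrm{pr}_2)(\alpha)$, for $\mathrm{pr}_1,\mathrm{pr}_2$ the projections from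 $X\times A$. $P_{(X,\varphi)}$ is a primary doctrine and $(F_X,\mathfrak f)$ is primary. For a primary doctrine $R:\mathbb D^{\mathrm{op}}\to\mathbf{Pos}$, the category $\mathbf{PD}_{(X,\varphi)}(P,R)$ has as objects the pairs $\big((G,\mathfrak g),c\big)$ with $(G,\mathfrak g)\in\mathbf{PD}(P,R)$ and $c:\mathbf t_{\mathbb D}\to GX$ an arrow of $\mathbb D$ such that $\top\le R(c)\mathfrak g_X(\varphi)$ in $R(\mathbf t_{\mathbb D})$; an arrow $\big((G,\mathfrak g),c\big)\to\big((H,\mathfrak h),d\big)$ is a 2-cell $\theta:(G,\mathfrak g)\to(H,\mathfrak h)$ such that $\theta_X\circ c=d$. Conventions: $\mathbf t$ denotes a terminal object. The arrow $\mathrm{id}_X:\mathbf t\rightsquigarrow X$ of $\mathbb C_X$ is the $\mathbb C$-arrow $\mathrm{pr}_1:X\times\mathbf t\to X$, where $X\times\mathbf t$ is identified with $X$. The arrow $K(\mathrm{id}_X)$ is regarded as having domain $\mathbf t_{\mathbb D}$ via the canonical isomorphism $K(\mathbf t)\cong\mathbf t_{\mathbb D}$. *)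

theory Defs
  imports "HOL-Algebra.Lattice"
begin

section \<open>Categories, functors and natural transformations\<close>

text \<open>
  A category is given by a family of hom-sets indexed by pairs of objects. The hom-sets need not be
  pairwise disjoint, so composition carries the three objects as arguments:
  \<open>Cmp C A B D g f\<close> is the composite of \<open>f : A \<rightarrow> B\<close> and \<open>g : B \<rightarrow> D\<close>. This matters for the Kleisli
  category below, where one and the same arrow may belong to several hom-sets.
\<close>

record ('o, 'a) cat =
  Ob  :: "'o set"
  Hom :: "'o \<Rightarrow> 'o \<Rightarrow> 'a set"
  Idn :: "'o \<Rightarrow> 'a"
  Cmp :: "'o \<Rightarrow> 'o \<Rightarrow> 'o \<Rightarrow> 'a \<Rightarrow> 'a \<Rightarrow> 'a"

locale category =
  fixes C :: "('o, 'a, 'm) cat_scheme"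
  assumes Idn_Hom: "A \<in> Ob C \<Longrightarrow> Idn C A \<in> Hom C A A"
    and Cmp_Hom:
      "\<lbrakk>A \<in> Ob C; B \<in> Ob C; D \<in> Ob C; f \<in> Hom C A B; g \<in> Hom C B D\<rbrakk>
        \<Longrightarrow> Cmp C A B D g f \<in> Hom C A D"
    and Cmp_Idn_left:
      "\<lbrakk>A \<in> Ob C; B \<in> Ob C; f \<in> Hom C A B\<rbrakk> \<Longrightarrow> Cmp C A B B (Idn C B) f = f"
    and Cmp_Idn_right:
      "\<lbrakk>A \<in> Ob C; B \<in> Ob C; f \<in> Hom C A B\<rbrakk> \<Longrightarrow> Cmp C A A B f (Idn C A) = f"
    and Cmp_assoc:
      "\<lbrakk>A \<in> Ob C; B \<in> Ob C; D \<in> Ob C; E \<in> Ob C;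
        f \<in> Hom C A B; g \<in> Hom C B D; h \<in> Hom C D E\<rbrakk>
        \<Longrightarrow> Cmp C A D E h (Cmp C A B D g f) = Cmp C A B E (Cmp C B D E h g) f"

definition is_inverse ::
  "('o, 'a, 'm) cat_scheme \<Rightarrow> 'o \<Rightarrow> 'o \<Rightarrow> 'a \<Rightarrow> 'a \<Rightarrow> bool" where
  "is_inverse C A B f g \<longleftrightarrow> f \<in> Hom C A B \<and> g \<in> Hom C B A
     \<and> Cmp C A B A g f = Idn C A \<and> Cmp C B A B f g = Idn C B"

definition is_iso :: "('o, 'a, 'm) cat_scheme \<Rightarrow> 'o \<Rightarrow> 'o \<Rightarrow> 'a \<Rightarrow> bool" where
  "is_iso C A B f \<longleftrightarrow> (\<exists>g. is_inverse C A B f g)"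

text \<open>
  Functors and natural transformations are determined by their values on the objects and arrows of
  the domain: outside of these they are required to be \<open>undefined\<close>, so that HOL equality
  is the intended equality.
\<close>

record ('o, 'a, 'u, 'b) func =
  Fob  :: "'o \<Rightarrow> 'u"
  Farr :: "'o \<Rightarrow> 'o \<Rightarrow> 'a \<Rightarrow> 'b"

definition mk_func ::
  "('o, 'a, 'm) cat_scheme \<Rightarrow> ('o \<Rightarrow> 'u) \<Rightarrow> ('o \<Rightarrow> 'o \<Rightarrow> 'a \<Rightarrow> 'b) \<Rightarrow> ('o, 'a, 'u, 'b) func" where
  "mk_func C F0 F1 =
     \<lparr>Fob = restrict F0 (Ob C),
      Farr = (\<lambda>A B f. if A \<in> Ob C \<and> B \<in> Ob C \<and> f \<in> Hom C A B then F1 A B f else undefined)\<rparr>"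

definition is_functor ::
  "('o, 'a, 'm) cat_scheme \<Rightarrow> ('u, 'b, 'n) cat_scheme \<Rightarrow> ('o, 'a, 'u, 'b) func \<Rightarrow> bool" where
  "is_functor C D F \<longleftrightarrow>
     category C \<and> category D \<and>
     F = mk_func C (Fob F) (Farr F) \<and>
     (\<forall>A\<in>Ob C. Fob F A \<in> Ob D) \<and>
     (\<forall>A\<in>Ob C. \<forall>B\<in>Ob C. \<forall>f\<in>Hom C A B. Farr F A B f \<in> Hom D (Fob F A) (Fob F B)) \<and>
     (\<forall>A\<in>Ob C. Farr F A A (Idn C A) = Idn D (Fob F A)) \<and>
     (\<forall>A\<in>Ob C. \<forall>B\<in>Ob C. \<forall>E\<in>Ob C. \<forall>f\<in>Hom C A B. \<forall>g\<in>Hom C B E.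
        Farr F A E (Cmp C A B E g f)
          = Cmp D (Fob F A) (Fob F B) (Fob F E) (Farr F B E g) (Farr F A B f))"

definition id_func :: "('o, 'a, 'm) cat_scheme \<Rightarrow> ('o, 'a, 'o, 'a) func" where
  "id_func C = mk_func C (\<lambda>A. A) (\<lambda>A B f. f)"

definition comp_func ::
  "('o, 'a, 'm) cat_scheme \<Rightarrow> ('u, 'b, 'v, 'c) func \<Rightarrow> ('o, 'a, 'u, 'b) func
    \<Rightarrow> ('o, 'a, 'v, 'c) func" where
  "comp_func C G F =
     mk_func C (\<lambda>A. Fob G (Fob F A)) (\<lambda>A B f. Farr G (Fob F A) (Fob F B) (Farr F A B f))"

definition is_nat_trans ::
  "('o, 'a, 'm) cat_scheme \<Rightarrow> ('u, 'b, 'n) cat_scheme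
    \<Rightarrow> ('o, 'a, 'u, 'b) func \<Rightarrow> ('o, 'a, 'u, 'b) func \<Rightarrow> ('o \<Rightarrow> 'b) \<Rightarrow> bool" where
  "is_nat_trans C D F G \<theta> \<longleftrightarrow>
     is_functor C D F \<and> is_functor C D G \<and>
     \<theta> \<in> extensional (Ob C) \<and>
     (\<forall>A\<in>Ob C. \<theta> A \<in> Hom D (Fob F A) (Fob G A)) \<and>
     (\<forall>A\<in>Ob C. \<forall>B\<in>Ob C. \<forall>f\<in>Hom C A B.
        Cmp D (Fob F A) (Fob F B) (Fob G B) (\<theta> B) (Farr F A B f)
          = Cmp D (Fob F A) (Fob G A) (Fob G B) (Farr G A B f) (\<theta> A))"

definition is_nat_iso ::
  "('o, 'a, 'm) cat_scheme \<Rightarrow> ('u, 'b, 'n) cat_scheme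
    \<Rightarrow> ('o, 'a, 'u, 'b) func \<Rightarrow> ('o, 'a, 'u, 'b) func \<Rightarrow> ('o \<Rightarrow> 'b) \<Rightarrow> bool" where
  "is_nat_iso C D F G \<theta> \<longleftrightarrow>
     is_nat_trans C D F G \<theta> \<and> (\<forall>A\<in>Ob C. is_iso D (Fob F A) (Fob G A) (\<theta> A))"

definition is_equivalence ::
  "('o, 'a, 'm) cat_scheme \<Rightarrow> ('u, 'b, 'n) cat_scheme \<Rightarrow> ('o, 'a, 'u, 'b) func \<Rightarrow> bool" where
  "is_equivalence C D F \<longleftrightarrow>
     is_functor C D F \<and>
     (\<exists>G \<eta> \<epsilon>. is_functor D C G \<and>
        is_nat_iso C C (id_func C) (comp_func C G F) \<eta> \<and>
        is_nat_iso D D (comp_func D F G) (id_func D) \<epsilon>)"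


section \<open>Finite products\<close>

definition is_terminal :: "('o, 'a, 'm) cat_scheme \<Rightarrow> 'o \<Rightarrow> bool" where
  "is_terminal C T \<longleftrightarrow> T \<in> Ob C \<and> (\<forall>A\<in>Ob C. \<exists>!f. f \<in> Hom C A T)"

definition is_product ::
  "('o, 'a, 'm) cat_scheme \<Rightarrow> 'o \<Rightarrow> 'o \<Rightarrow> 'o \<Rightarrow> 'a \<Rightarrow> 'a \<Rightarrow> bool" where
  "is_product C A B Q p q \<longleftrightarrow>
     A \<in> Ob C \<and> B \<in> Ob C \<and> Q \<in> Ob C \<and> p \<in> Hom C Q A \<and> q \<in> Hom C Q B \<and>
     (\<forall>Z\<in>Ob C. \<forall>f\<in>Hom C Z A. \<forall>g\<in>Hom C Z B.
        \<exists>!h. h \<in> Hom C Z Q \<and> Cmp C Z Q A p h = f \<and> Cmp C Z Q B q h = g)"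

text \<open>
  A category with finite products comes with a choice of a terminal object and of binary products.
  The choice is arbitrary, and preservation of finite products by a functor does not refer to it.
\<close>

record ('o, 'a) fpcat = "('o, 'a) cat" +
  Trm :: "'o"
  Prd :: "'o \<Rightarrow> 'o \<Rightarrow> 'o"
  Pr1 :: "'o \<Rightarrow> 'o \<Rightarrow> 'a"
  Pr2 :: "'o \<Rightarrow> 'o \<Rightarrow> 'a"

locale fp_category = category C for C :: "('o, 'a, 'm) fpcat_scheme" +
  assumes Trm_terminal: "is_terminal C (Trm C)"
    and Prd_product:
      "\<lbrakk>A \<in> Ob C; B \<in> Ob C\<rbrakk> \<Longrightarrow> is_product C A B (Prd C A B) (Pr1 C A B) (Pr2 C A B)"

definition tuple ::
  "('o, 'a, 'm) fpcat_scheme \<Rightarrow> 'o \<Rightarrow> 'o \<Rightarrow> 'o \<Rightarrow> 'a \<Rightarrow> 'a \<Rightarrow> 'a" where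
  "tuple C Z A B f g =
     (THE h. h \<in> Hom C Z (Prd C A B)
        \<and> Cmp C Z (Prd C A B) A (Pr1 C A B) h = f
        \<and> Cmp C Z (Prd C A B) B (Pr2 C A B) h = g)"

definition bang :: "('o, 'a, 'm) cat_scheme \<Rightarrow> 'o \<Rightarrow> 'o \<Rightarrow> 'a" where
  "bang C A T = (THE f. f \<in> Hom C A T)"

definition preserves_fp ::
  "('o, 'a, 'm) cat_scheme \<Rightarrow> ('u, 'b, 'n) cat_scheme \<Rightarrow> ('o, 'a, 'u, 'b) func \<Rightarrow> bool" where
  "preserves_fp C D F \<longleftrightarrow>
     (\<forall>T. is_terminal C T \<longrightarrow> is_terminal D (Fob F T)) \<and>
     (\<forall>A B Q p q. is_product C A B Q p q \<longrightarrow>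
        is_product D (Fob F A) (Fob F B) (Fob F Q) (Farr F Q A p) (Farr F Q B q))"


section \<open>Doctrines\<close>

text \<open>\<open>Rdx P A B f\<close> is the reindexing \<open>P(f) : P(B) \<rightarrow> P(A)\<close> along \<open>f : A \<rightarrow> B\<close>.\<close>

record ('o, 'a, 'p) doctrine =
  Base :: "('o, 'a) fpcat"
  Fib  :: "'o \<Rightarrow> 'p gorder"
  Rdx  :: "'o \<Rightarrow> 'o \<Rightarrow> 'a \<Rightarrow> 'p \<Rightarrow> 'p"

definition is_doctrine :: "('o, 'a, 'p) doctrine \<Rightarrow> bool" where
  "is_doctrine P \<longleftrightarrow>
     fp_category (Base P) \<and>
     (\<forall>A\<in>Ob (Base P). partial_order (Fib P A)) \<and>
     (\<forall>A\<in>Ob (Base P). \<forall>B\<in>Ob (Base P). \<forall>f\<in>Hom (Base P) A B.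
        Rdx P A B f \<in> carrier (Fib P B) \<rightarrow> carrier (Fib P A) \<and>
        isotone (Fib P B) (Fib P A) (Rdx P A B f)) \<and>
     (\<forall>A\<in>Ob (Base P). \<forall>\<alpha>\<in>carrier (Fib P A). Rdx P A A (Idn (Base P) A) \<alpha> = \<alpha>) \<and>
     (\<forall>A\<in>Ob (Base P). \<forall>B\<in>Ob (Base P). \<forall>E\<in>Ob (Base P).
        \<forall>f\<in>Hom (Base P) A B. \<forall>g\<in>Hom (Base P) B E. \<forall>\<alpha>\<in>carrier (Fib P E).
        Rdx P A E (Cmp (Base P) A B E g f) \<alpha> = Rdx P A B f (Rdx P B E g \<alpha>))"

definition has_finite_meets :: "'p gorder \<Rightarrow> bool" where
  "has_finite_meets L \<longleftrightarrow> lower_semilattice L \<and> weak_partial_order_top L"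

definition preserves_finite_meets :: "'p gorder \<Rightarrow> 'q gorder \<Rightarrow> ('p \<Rightarrow> 'q) \<Rightarrow> bool" where
  "preserves_finite_meets L M h \<longleftrightarrow>
     h \<top>\<^bsub>L\<^esub> = \<top>\<^bsub>M\<^esub> \<and>
     (\<forall>x\<in>carrier L. \<forall>y\<in>carrier L. h (x \<sqinter>\<^bsub>L\<^esub> y) = h x \<sqinter>\<^bsub>M\<^esub> h y)"

definition is_primary :: "('o, 'a, 'p) doctrine \<Rightarrow> bool" where
  "is_primary P \<longleftrightarrow>
     is_doctrine P \<and>
     (\<forall>A\<in>Ob (Base P). has_finite_meets (Fib P A)) \<and>
     (\<forall>A\<in>Ob (Base P). \<forall>B\<in>Ob (Base P). \<forall>f\<in>Hom (Base P) A B.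
        preserves_finite_meets (Fib P B) (Fib P A) (Rdx P A B f))"

type_synonym ('o, 'a, 'p, 'u, 'b, 'q) arrow1 =
  "('o, 'a, 'u, 'b) func \<times> ('o \<Rightarrow> 'p \<Rightarrow> 'q)"

definition mk_fib :: "('o, 'a, 'p) doctrine \<Rightarrow> ('o \<Rightarrow> 'p \<Rightarrow> 'q) \<Rightarrow> 'o \<Rightarrow> 'p \<Rightarrow> 'q" where
  "mk_fib P m = (\<lambda>A\<in>Ob (Base P). \<lambda>\<alpha>\<in>carrier (Fib P A). m A \<alpha>)"

definition is_arrow1 ::
  "('o, 'a, 'p) doctrine \<Rightarrow> ('u, 'b, 'q) doctrine \<Rightarrow> ('o, 'a, 'p, 'u, 'b, 'q) arrow1 \<Rightarrow> bool" where
  "is_arrow1 P R = (\<lambda>(F, m).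
     is_doctrine P \<and> is_doctrine R \<and>
     is_functor (Base P) (Base R) F \<and> preserves_fp (Base P) (Base R) F \<and>
     m = mk_fib P m \<and>
     (\<forall>A\<in>Ob (Base P).
        m A \<in> carrier (Fib P A) \<rightarrow> carrier (Fib R (Fob F A)) \<and>
        isotone (Fib P A) (Fib R (Fob F A)) (m A)) \<and>
     (\<forall>A\<in>Ob (Base P). \<forall>B\<in>Ob (Base P). \<forall>f\<in>Hom (Base P) A B. \<forall>\<alpha>\<in>carrier (Fib P B).
        m A (Rdx P A B f \<alpha>) = Rdx R (Fob F A) (Fob F B) (Farr F A B f) (m B \<alpha>)))"

definition is_primary_arrow1 ::
  "('o, 'a, 'p) doctrine \<Rightarrow> ('u, 'b, 'q) doctrine \<Rightarrow> ('o, 'a, 'p, 'u, 'b, 'q) arrow1 \<Rightarrow> bool" where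
  "is_primary_arrow1 P R = (\<lambda>(F, m).
     is_primary P \<and> is_primary R \<and> is_arrow1 P R (F, m) \<and>
     (\<forall>A\<in>Ob (Base P). preserves_finite_meets (Fib P A) (Fib R (Fob F A)) (m A)))"

definition comp_arrow1 ::
  "('o, 'a, 'p) doctrine \<Rightarrow> ('u, 'b, 'q, 'v, 'c, 'r) arrow1 \<Rightarrow> ('o, 'a, 'p, 'u, 'b, 'q) arrow1
    \<Rightarrow> ('o, 'a, 'p, 'v, 'c, 'r) arrow1" where
  "comp_arrow1 P = (\<lambda>(G, n) (F, m).
     (comp_func (Base P) G F, mk_fib P (\<lambda>A \<alpha>. n (Fob F A) (m A \<alpha>))))"

definition is_cell2 ::
  "('o, 'a, 'p) doctrine \<Rightarrow> ('u, 'b, 'q) doctrine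
    \<Rightarrow> ('o, 'a, 'p, 'u, 'b, 'q) arrow1 \<Rightarrow> ('o, 'a, 'p, 'u, 'b, 'q) arrow1 \<Rightarrow> ('o \<Rightarrow> 'b) \<Rightarrow> bool"
  where
  "is_cell2 P R = (\<lambda>(F, m) (G, n) \<theta>.
     is_nat_trans (Base P) (Base R) F G \<theta> \<and>
     (\<forall>A\<in>Ob (Base P). \<forall>\<alpha>\<in>carrier (Fib P A).
        m A \<alpha> \<sqsubseteq>\<^bsub>Fib R (Fob F A)\<^esub> Rdx R (Fob F A) (Fob G A) (\<theta> A) (n A \<alpha>)))"

definition id_cell2 ::
  "('o, 'a, 'p) doctrine \<Rightarrow> ('u, 'b, 'q) doctrine \<Rightarrow> ('o, 'a, 'p, 'u, 'b, 'q) arrow1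
    \<Rightarrow> 'o \<Rightarrow> 'b" where
  "id_cell2 P R = (\<lambda>(F, m). \<lambda>A\<in>Ob (Base P). Idn (Base R) (Fob F A))"

definition vcomp_cell2 ::
  "('o, 'a, 'p) doctrine \<Rightarrow> ('u, 'b, 'q) doctrine
    \<Rightarrow> ('o, 'a, 'p, 'u, 'b, 'q) arrow1 \<Rightarrow> ('o, 'a, 'p, 'u, 'b, 'q) arrow1
    \<Rightarrow> ('o, 'a, 'p, 'u, 'b, 'q) arrow1 \<Rightarrow> ('o \<Rightarrow> 'b) \<Rightarrow> ('o \<Rightarrow> 'b) \<Rightarrow> 'o \<Rightarrow> 'b" where
  "vcomp_cell2 P R = (\<lambda>(F, m) (G, n) (H, k) \<theta>' \<theta>.
     \<lambda>A\<in>Ob (Base P). Cmp (Base R) (Fob F A) (Fob G A) (Fob H A) (\<theta>' A) (\<theta> A))"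

definition PD ::
  "('o, 'a, 'p) doctrine \<Rightarrow> ('u, 'b, 'q) doctrine
    \<Rightarrow> (('o, 'a, 'p, 'u, 'b, 'q) arrow1, 'o \<Rightarrow> 'b) cat" where
  "PD P R =
     \<lparr>Ob = {M. is_primary_arrow1 P R M},
      Hom = (\<lambda>M N. {\<theta>. is_cell2 P R M N \<theta>}),
      Idn = id_cell2 P R,
      Cmp = vcomp_cell2 P R\<rparr>"

definition PD_at ::
  "('o, 'a, 'p) doctrine \<Rightarrow> 'o \<Rightarrow> 'p \<Rightarrow> ('u, 'b, 'q) doctrine
    \<Rightarrow> (('o, 'a, 'p, 'u, 'b, 'q) arrow1 \<times> 'b, 'o \<Rightarrow> 'b) cat" where
  "PD_at P X \<phi> R =
     \<lparr>Ob = {((G, m), c) | G m c.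
        is_primary_arrow1 P R (G, m) \<and>
        c \<in> Hom (Base R) (Trm (Base R)) (Fob G X) \<and>
        \<top>\<^bsub>Fib R (Trm (Base R))\<^esub>
          \<sqsubseteq>\<^bsub>Fib R (Trm (Base R))\<^esub> Rdx R (Trm (Base R)) (Fob G X) c (m X \<phi>)},
      Hom = (\<lambda>((G, m), c) ((H, n), d).
        {\<theta>. is_cell2 P R (G, m) (H, n) \<theta> \<and>
            Cmp (Base R) (Trm (Base R)) (Fob G X) (Fob H X) (\<theta> X) c = d}),
      Idn = (\<lambda>(M, c). id_cell2 P R M),
      Cmp = (\<lambda>(M, c) (N, d) (L, e). vcomp_cell2 P R M N L)\<rparr>"


section \<open>The Kleisli doctrine\<close>

text \<open>
  Terminal object and products on objects are those of \<open>C\<close>; the projections are the images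
  \<open>pr\<^sub>i \<circ> pr\<^sub>2 : X \<times> (A \<times> B) \<rightarrow> A, B\<close> of the projections of \<open>C\<close>.
\<close>

definition kleisli_cat :: "('o, 'a) fpcat \<Rightarrow> 'o \<Rightarrow> ('o, 'a) fpcat" where
  "kleisli_cat C X =
     \<lparr>Ob = Ob C,
      Hom = (\<lambda>A B. Hom C (Prd C X A) B),
      Idn = (\<lambda>A. Pr2 C X A),
      Cmp = (\<lambda>A B E h g. Cmp C (Prd C X A) (Prd C X B) E h
               (tuple C (Prd C X A) X B (Pr1 C X A) g)),
      Trm = Trm C,
      Prd = Prd C,
      Pr1 = (\<lambda>A B. Cmp C (Prd C X (Prd C A B)) (Prd C A B) A (Pr1 C A B) (Pr2 C X (Prd C A B))),
      Pr2 = (\<lambda>A B. Cmp C (Prd C X (Prd C A B)) (Prd C A B) B (Pr2 C A B) (Pr2 C X (Prd C A B)))\<rparr>"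

definition kleisli_doctrine :: "('o, 'a, 'p) doctrine \<Rightarrow> 'o \<Rightarrow> 'p \<Rightarrow> ('o, 'a, 'p) doctrine" where
  "kleisli_doctrine P X \<phi> = (let C = Base P in
     \<lparr>Base = kleisli_cat C X,
      Fib = (\<lambda>A. (Fib P (Prd C X A))
               \<lparr>carrier := {\<alpha> \<in> carrier (Fib P (Prd C X A)).
                  \<alpha> \<sqsubseteq>\<^bsub>Fib P (Prd C X A)\<^esub> Rdx P (Prd C X A) X (Pr1 C X A) \<phi>}\<rparr>),
      Rdx = (\<lambda>A B g. Rdx P (Prd C X A) (Prd C X B)
               (tuple C (Prd C X A) X B (Pr1 C X A) g))\<rparr>)"

definition kleisli_arrow1 ::
  "('o, 'a, 'p) doctrine \<Rightarrow> 'o \<Rightarrow> 'p \<Rightarrow> ('o, 'a, 'p, 'o, 'a, 'p) arrow1" where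
  "kleisli_arrow1 P X \<phi> = (let C = Base P in
     (mk_func C (\<lambda>A. A) (\<lambda>A B f. Cmp C (Prd C X A) A B f (Pr2 C X A)),
      mk_fib P (\<lambda>A \<alpha>. Rdx P (Prd C X A) X (Pr1 C X A) \<phi>
                 \<sqinter>\<^bsub>Fib P (Prd C X A)\<^esub> Rdx P (Prd C X A) A (Pr2 C X A) \<alpha>)))"

text \<open>
  The arrow \<open>K(id\<^sub>X)\<close>, for \<open>K : \<complex>\<^sub>X \<rightarrow> \<D>\<close>. The arrow \<open>id\<^sub>X : \<t> \<leadsto> X\<close> of the Kleisli category is the
  projection \<open>X \<times> \<t> \<rightarrow> X\<close>; its image \<open>K(\<t>) \<rightarrow> K(X)\<close> is precomposed with the inverse
  \<open>\<t> \<rightarrow> K(\<t>)\<close> of the canonical isomorphism \<open>K(\<t>) \<rightarrow> \<t>\<close>.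
\<close>

definition generic_point ::
  "('o, 'a) fpcat \<Rightarrow> ('u, 'b) fpcat \<Rightarrow> 'o \<Rightarrow> ('o, 'a, 'u, 'b) func \<Rightarrow> 'b" where
  "generic_point C D X K =
     Cmp D (Trm D) (Fob K (Trm C)) (Fob K X)
       (Farr K (Trm C) X (Pr1 C X (Trm C)))
       (THE i. is_inverse D (Fob K (Trm C)) (Trm D) (bang D (Fob K (Trm C)) (Trm D)) i)"

text \<open>Precomposition with \<open>(F\<^sub>X, \<ff>)\<close>, sending a 2-cell \<open>\<xi>\<close> to \<open>\<xi>\<close> whiskered with \<open>F\<^sub>X\<close>.\<close>

definition kleisli_precomp ::
  "('o, 'a, 'p) doctrine \<Rightarrow> 'o \<Rightarrow> 'p \<Rightarrow> ('u, 'b, 'q) doctrine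
    \<Rightarrow> (('o, 'a, 'p, 'u, 'b, 'q) arrow1, 'o \<Rightarrow> 'b,
        ('o, 'a, 'p, 'u, 'b, 'q) arrow1 \<times> 'b, 'o \<Rightarrow> 'b) func" where
  "kleisli_precomp P X \<phi> R =
     mk_func (PD (kleisli_doctrine P X \<phi>) R)
       (\<lambda>(K, k). (comp_arrow1 P (K, k) (kleisli_arrow1 P X \<phi>),
                  generic_point (Base P) (Base R) X K))
       (\<lambda>M N \<xi>. \<lambda>A\<in>Ob (Base P). \<xi> (Fob (fst (kleisli_arrow1 P X \<phi>)) A))"

end

(*
  Every Kleisli arrow g : A ~> B is the composite of eta = id_{X x A} : A ~> X x A with F_X(g),
  and eta is determined by its components K(pr_1) = K(id_X) o K(!) and the identity, because K
  preserves the product X x A. Hence a 2-cell between composites with F_X that respects the generic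
  points is automatically natural for all Kleisli arrows. Likewise every alpha in P_(X,phi)(A) is
  the reindexing along eta of f_{X x A}(alpha), which gives the inequality of a 2-cell. So
  precomposition is fully faithful, and it is the identity on hom-sets.

  It is strictly surjective on objects: given (G, g) and c, let s_A : GA -> G(X x A) be the arrow
  with components c o ! and id. Then K(f) = G(f) o s_A and k_A(alpha) = R(s_A)(g_{X x A}(alpha))
  define a 1-arrow whose composite with (F_X, f) is (G, g) on the nose, with generic point c.
*)

theory Submission
  imports Defs
begin

section \<open>Categories, functors and equivalences\<close>

text \<open>C_X is the co-Kleisli category of the comonad X x (-), and the formulas for the
  extension are forced. If K restricts to G and has generic point c, then K(eta_A) has components c
  o ! and id with respect to the product cone G(X x A), so it is s_A; factoring f and alpha through
  eta_A then leaves no choice for K(f) and k_A(alpha). What remains is that s is compatible with the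
  substitutions <pr_1, f>, which gives functoriality of K and naturality of k, and that R(s_A) sends
  g(P(pr_1)(phi)) to top. The latter is where top <= R(c) g_X(phi) enters; it makes k preserve top
  and also makes the composite with F_X agree with g strictly. Strict surjectivity shapes the final
  argument: with a section on objects and equal hom-sets the counit is an identity, and no
  isomorphism of 1-arrows has to be constructed. The obstacle is that K(t) is terminal without being
  the chosen terminal object of the codomain. An equation between generic points is therefore not
  literally a naturality square at id_X : t ~> X; it becomes one by cancelling the isomorphism K(t)
  -> t, and terminality of K'(t) identifies the remaining arrows.\<close>

context category
begin

lemmas cat_simps [simp] = Idn_Hom Cmp_Hom Cmp_Idn_left Cmp_Idn_right

text \<open>Composites nested to the right are the normal form throughout. Where a composite has to
  be regrouped, \<open>Cmp_assoc\<close> is applied with this rule switched off.\<close>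

lemma Cmp_reassoc [simp]:
  "\<lbrakk>A \<in> Ob C; B \<in> Ob C; D \<in> Ob C; E \<in> Ob C;
    f \<in> Hom C A B; g \<in> Hom C B D; h \<in> Hom C D E\<rbrakk>
    \<Longrightarrow> Cmp C A B E (Cmp C B D E h g) f = Cmp C A D E h (Cmp C A B D g f)"
  by (simp add: Cmp_assoc)

end

lemma (in category) is_inverse_unique:
  assumes "A \<in> Ob C" "B \<in> Ob C" "is_inverse C A B f g" "is_inverse C A B f g'"
  shows "g = g'"
  using Cmp_assoc[of B A B A g f g'] assms by (simp add: is_inverse_def del: Cmp_reassoc)

lemma mk_func_simps [simp]:
  "A \<in> Ob C \<Longrightarrow> Fob (mk_func C F0 F1) A = F0 A"
  "\<lbrakk>A \<in> Ob C; B \<in> Ob C; f \<in> Hom C A B\<rbrakk> \<Longrightarrow> Farr (mk_func C F0 F1) A B f = F1 A B f"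
  by (auto simp: mk_func_def)

lemma mk_func_cong:
  assumes "\<And>A. A \<in> Ob C \<Longrightarrow> F0 A = G0 A"
    and "\<And>A B f. \<lbrakk>A \<in> Ob C; B \<in> Ob C; f \<in> Hom C A B\<rbrakk> \<Longrightarrow> F1 A B f = G1 A B f"
  shows "mk_func C F0 F1 = mk_func C G0 G1"
  using assms by (auto simp: mk_func_def restrict_def fun_eq_iff)

text \<open>This is the extensionality clause of \<open>is_functor\<close> for anything built by
  \<open>mk_func\<close>.\<close>

lemma mk_func_idem [simp]:
  "mk_func C (Fob (mk_func C F0 F1)) (Farr (mk_func C F0 F1)) = mk_func C F0 F1"
  by (rule mk_func_cong) auto

lemma mk_fib_simps [simp]:
  "\<lbrakk>A \<in> Ob (Base P); \<alpha> \<in> carrier (Fib P A)\<rbrakk> \<Longrightarrow> mk_fib P m A \<alpha> = m A \<alpha>"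
  by (auto simp: mk_fib_def)

lemma mk_fib_cong:
  assumes "\<And>A \<alpha>. \<lbrakk>A \<in> Ob (Base P); \<alpha> \<in> carrier (Fib P A)\<rbrakk> \<Longrightarrow> m A \<alpha> = n A \<alpha>"
  shows "mk_fib P m = mk_fib P n"
  using assms by (auto simp: mk_fib_def restrict_def fun_eq_iff)

lemma mk_fib_idem [simp]: "mk_fib P (mk_fib P m) = mk_fib P m"
  by (rule mk_fib_cong) auto

lemma is_functorD:
  assumes "is_functor C D F"
  shows is_functor_dom: "category C"
    and is_functor_cod: "category D"
    and is_functor_ext: "mk_func C (Fob F) (Farr F) = F"
    and Fob_Ob: "A \<in> Ob C \<Longrightarrow> Fob F A \<in> Ob D"
    and Farr_Hom: "\<lbrakk>A \<in> Ob C; B \<in> Ob C; f \<in> Hom C A B\<rbrakk>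
      \<Longrightarrow> Farr F A B f \<in> Hom D (Fob F A) (Fob F B)"
    and Farr_Idn: "A \<in> Ob C \<Longrightarrow> Farr F A A (Idn C A) = Idn D (Fob F A)"
    and Farr_Cmp: "\<lbrakk>A \<in> Ob C; B \<in> Ob C; E \<in> Ob C; f \<in> Hom C A B; g \<in> Hom C B E\<rbrakk>
      \<Longrightarrow> Farr F A E (Cmp C A B E g f)
          = Cmp D (Fob F A) (Fob F B) (Fob F E) (Farr F B E g) (Farr F A B f)"
  using assms unfolding is_functor_def by (blast, blast, metis, blast+)

lemmas functor_simps = Fob_Ob Farr_Hom Farr_Idn Farr_Cmp

lemma is_functor_mk_func:
  assumes "category C" "category D"
    and "\<And>A. A \<in> Ob C \<Longrightarrow> F0 A \<in> Ob D"
    and "\<And>A B f. \<lbrakk>A \<in> Ob C; B \<in> Ob C; f \<in> Hom C A B\<rbrakk> \<Longrightarrow> F1 A B f \<in> Hom D (F0 A) (F0 B)"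
    and "\<And>A. A \<in> Ob C \<Longrightarrow> F1 A A (Idn C A) = Idn D (F0 A)"
    and "\<And>A B E f g. \<lbrakk>A \<in> Ob C; B \<in> Ob C; E \<in> Ob C; f \<in> Hom C A B; g \<in> Hom C B E\<rbrakk>
      \<Longrightarrow> F1 A E (Cmp C A B E g f) = Cmp D (F0 A) (F0 B) (F0 E) (F1 B E g) (F1 A B f)"
  shows "is_functor C D (mk_func C F0 F1)"
  using assms by (simp add: is_functor_def category.cat_simps)

lemma is_functor_id_func: "category C \<Longrightarrow> is_functor C C (id_func C)"
  unfolding id_func_def by (rule is_functor_mk_func) auto

lemma is_functor_comp_func:
  assumes "is_functor C D F" "is_functor D E G"
  shows "is_functor C E (comp_func C G F)"
  unfolding comp_func_def
  by (rule is_functor_mk_func)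
    (use assms in \<open>auto simp: functor_simps[OF assms(1)] functor_simps[OF assms(2)]
       dest: is_functor_dom is_functor_cod\<close>)

lemma functor_eqI:
  assumes "is_functor C D F" "is_functor C D G"
    and "\<And>A. A \<in> Ob C \<Longrightarrow> Fob F A = Fob G A"
    and "\<And>A B f. \<lbrakk>A \<in> Ob C; B \<in> Ob C; f \<in> Hom C A B\<rbrakk> \<Longrightarrow> Farr F A B f = Farr G A B f"
  shows "F = G"
  using mk_func_cong[of C "Fob F" "Fob G" "Farr F" "Farr G"] assms
  by (metis is_functor_ext)

section \<open>Natural transformations and their composites\<close>

lemma is_nat_transD:
  assumes "is_nat_trans C D F G \<theta>"
  shows nat_trans_dom: "is_functor C D F"
    and nat_trans_cod: "is_functor C D G"
    and nat_trans_ext: "\<theta> \<in> extensional (Ob C)"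
    and nat_trans_Hom: "A \<in> Ob C \<Longrightarrow> \<theta> A \<in> Hom D (Fob F A) (Fob G A)"
    and nat_trans_sq: "\<lbrakk>A \<in> Ob C; B \<in> Ob C; f \<in> Hom C A B\<rbrakk>
      \<Longrightarrow> Cmp D (Fob F A) (Fob F B) (Fob G B) (\<theta> B) (Farr F A B f)
          = Cmp D (Fob F A) (Fob G A) (Fob G B) (Farr G A B f) (\<theta> A)"
  using assms unfolding is_nat_trans_def by blast+

lemma is_nat_trans_Idn:
  assumes "is_functor C D F"
  shows "is_nat_trans C D F F (\<lambda>A\<in>Ob C. Idn D (Fob F A))"
proof -
  interpret D: category D by (rule is_functor_cod[OF assms])
  show ?thesis
    using assms by (auto simp: is_nat_trans_def functor_simps[OF assms])
qed

lemma is_nat_trans_Cmp: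
  assumes "is_nat_trans C D F G \<theta>" "is_nat_trans C D G H \<theta>'"
  shows "is_nat_trans C D F H (\<lambda>A\<in>Ob C. Cmp D (Fob F A) (Fob G A) (Fob H A) (\<theta>' A) (\<theta> A))"
proof -
  note F = nat_trans_dom[OF assms(1)] and G = nat_trans_cod[OF assms(1)]
    and H = nat_trans_cod[OF assms(2)]
  note simps = functor_simps[OF F] functor_simps[OF G] functor_simps[OF H]
    nat_trans_Hom[OF assms(1)] nat_trans_Hom[OF assms(2)]
  interpret D: category D by (rule is_functor_cod[OF F])
  have "Cmp D (Fob F A) (Fob F B) (Fob H B)
           (Cmp D (Fob F B) (Fob G B) (Fob H B) (\<theta>' B) (\<theta> B)) (Farr F A B f)
        = Cmp D (Fob F A) (Fob H A) (Fob H B) (Farr H A B f)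
           (Cmp D (Fob F A) (Fob G A) (Fob H A) (\<theta>' A) (\<theta> A))" (is "?l = ?r")
    if A: "A \<in> Ob C" and B: "B \<in> Ob C" and f: "f \<in> Hom C A B" for A B f
  proof -
    have "?l = Cmp D (Fob F A) (Fob G B) (Fob H B) (\<theta>' B)
                 (Cmp D (Fob F A) (Fob G A) (Fob G B) (Farr G A B f) (\<theta> A))"
      using that by (simp add: simps nat_trans_sq[OF assms(1)])
    also have "\<dots> = Cmp D (Fob F A) (Fob G A) (Fob H B)
                 (Cmp D (Fob G A) (Fob G B) (Fob H B) (\<theta>' B) (Farr G A B f)) (\<theta> A)"
      using that by (simp add: simps)
    also have "\<dots> = ?r"
      using that by (simp only: nat_trans_sq[OF assms(2)]) (simp add: simps)
    finally show ?thesis .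
  qed
  then show ?thesis
    using F H by (auto simp: is_nat_trans_def simps)
qed

text \<open>The inverse functor is \<open>S\<close> on objects and takes preimages under F on
  hom-sets. Since F S is the identity on objects, F after this functor is the identity on the nose,
  so the counit consists of identities and only the unit needs a construction.\<close>

lemma is_equivalence_if_section:
  assumes F: "is_functor C D F"
    and S: "\<And>B. B \<in> Ob D \<Longrightarrow> S B \<in> Ob C" "\<And>B. B \<in> Ob D \<Longrightarrow> Fob F (S B) = B"
    and bij: "\<And>A A'. \<lbrakk>A \<in> Ob C; A' \<in> Ob C\<rbrakk>
      \<Longrightarrow> bij_betw (Farr F A A') (Hom C A A') (Hom D (Fob F A) (Fob F A'))"
  shows "is_equivalence C D F"
proof -
  interpret C: category C by (rule is_functor_dom[OF F])
  interpret D: category D by (rule is_functor_cod[OF F])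
  note Fs = functor_simps[OF F]
  define inv where "inv A A' = the_inv_into (Hom C A A') (Farr F A A')" for A A'
  have inv_Hom [simp]: "inv A A' h \<in> Hom C A A'"
    if "A \<in> Ob C" "A' \<in> Ob C" "h \<in> Hom D (Fob F A) (Fob F A')" for A A' h
    using bij[OF that(1,2)] that(3) unfolding inv_def bij_betw_def
    by (metis the_inv_into_into subset_refl)
  have F_inv [simp]: "Farr F A A' (inv A A' h) = h"
    if "A \<in> Ob C" "A' \<in> Ob C" "h \<in> Hom D (Fob F A) (Fob F A')" for A A' h
    using bij[OF that(1,2)] that(3) unfolding inv_def bij_betw_def
    by (metis f_the_inv_into_f)
  \<comment> \<open>Faithfulness turns each equation in C below into an equation in D, where
    \<open>F_inv\<close> and functoriality settle it.\<close>
  have F_inj: "f = g" if "Farr F A A' f = Farr F A A' g"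
    "A \<in> Ob C" "A' \<in> Ob C" "f \<in> Hom C A A'" "g \<in> Hom C A A'" for A A' f g
    using bij[OF that(2,3)] that unfolding bij_betw_def by (metis inj_onD)
  note simps = Fs S
  define G where "G = mk_func D S (\<lambda>B B'. inv (S B) (S B'))"
  have G: "is_functor D C G"
    unfolding G_def
  proof (rule is_functor_mk_func)
    fix B assume "B \<in> Ob D"
    then show "inv (S B) (S B) (Idn D B) = Idn C (S B)"
      by (intro F_inj[of "S B" "S B"]) (simp_all add: simps)
  next
    fix A B E f g
    assume "A \<in> Ob D" "B \<in> Ob D" "E \<in> Ob D" "f \<in> Hom D A B" "g \<in> Hom D B E"
    then show "inv (S A) (S E) (Cmp D A B E g f)
        = Cmp C (S A) (S B) (S E) (inv (S B) (S E) g) (inv (S A) (S B) f)"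
      by (intro F_inj[of "S A" "S E"]) (simp_all add: simps)
  qed (simp_all add: simps C.category_axioms D.category_axioms)
  have GF: "is_functor C C (comp_func C G F)"
    by (rule is_functor_comp_func[OF F G])
  have FG: "is_functor D D (comp_func D F G)"
    by (rule is_functor_comp_func[OF G F])
  \<comment> \<open>A and S(F A) have the same image under F, so the identity of F A has a preimage
    in each direction between them; these two preimages are mutually inverse.\<close>
  define \<eta> where "\<eta> = (\<lambda>A\<in>Ob C. inv A (S (Fob F A)) (Idn D (Fob F A)))"
  have "is_nat_iso C C (id_func C) (comp_func C G F) \<eta>"
    unfolding is_nat_iso_def is_nat_trans_def
  proof (intro conjI ballI is_functor_id_func GF C.category_axioms)
    fix A B f assume "A \<in> Ob C" "B \<in> Ob C" "f \<in> Hom C A B"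
    then show "Cmp C (Fob (id_func C) A) (Fob (id_func C) B) (Fob (comp_func C G F) B)
          (\<eta> B) (Farr (id_func C) A B f)
      = Cmp C (Fob (id_func C) A) (Fob (comp_func C G F) A) (Fob (comp_func C G F) B)
          (Farr (comp_func C G F) A B f) (\<eta> A)"
      by (intro F_inj[of A "S (Fob F B)"])
        (simp_all add: id_func_def comp_func_def G_def \<eta>_def simps)
  next
    fix A assume A: "A \<in> Ob C"
    have "is_inverse C A (S (Fob F A)) (\<eta> A) (inv (S (Fob F A)) A (Idn D (Fob F A)))"
      unfolding is_inverse_def
      by (intro conjI F_inj[of A A] F_inj[of "S (Fob F A)" "S (Fob F A)"])
        (simp_all add: \<eta>_def simps A)
    then show "is_iso C (Fob (id_func C) A) (Fob (comp_func C G F) A) (\<eta> A)"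
      unfolding is_iso_def using A by (auto simp: id_func_def comp_func_def G_def simps)
  qed (auto simp: id_func_def comp_func_def G_def \<eta>_def simps)
  moreover have "comp_func D F G = id_func D"
    by (rule functor_eqI[OF FG is_functor_id_func])
      (simp_all add: D.category_axioms comp_func_def id_func_def G_def simps)
  moreover have "is_nat_iso D D (id_func D) (id_func D) (\<lambda>B\<in>Ob D. Idn D B)"
    using is_nat_trans_Idn[OF is_functor_id_func[OF D.category_axioms]]
    by (auto simp: is_nat_iso_def id_func_def is_iso_def is_inverse_def cong: restrict_cong)
      (use D.Idn_Hom D.Cmp_Idn_left in blast)
  ultimately show ?thesis
    unfolding is_equivalence_def using F G by metis
qed

section \<open>Finite products\<close>

lemma is_terminalD:
  assumes "is_terminal C T"
  shows terminal_Ob: "T \<in> Ob C"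
    and terminal_ex: "A \<in> Ob C \<Longrightarrow> \<exists>f. f \<in> Hom C A T"
    and terminal_eq: "\<lbrakk>A \<in> Ob C; f \<in> Hom C A T; g \<in> Hom C A T\<rbrakk> \<Longrightarrow> f = g"
  using assms unfolding is_terminal_def by blast+

lemma is_productD:
  assumes "is_product C A B Q p q"
  shows product_Ob: "A \<in> Ob C" "B \<in> Ob C" "Q \<in> Ob C"
    and product_Hom: "p \<in> Hom C Q A" "q \<in> Hom C Q B"
    and product_ex: "\<lbrakk>Z \<in> Ob C; f \<in> Hom C Z A; g \<in> Hom C Z B\<rbrakk>
      \<Longrightarrow> \<exists>h. h \<in> Hom C Z Q \<and> Cmp C Z Q A p h = f \<and> Cmp C Z Q B q h = g"
  using assms unfolding is_product_def by blast+

lemma (in category) product_eqI: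
  assumes "is_product C A B Q p q" "Z \<in> Ob C" "h \<in> Hom C Z Q" "h' \<in> Hom C Z Q"
    and "Cmp C Z Q A p h = Cmp C Z Q A p h'" "Cmp C Z Q B q h = Cmp C Z Q B q h'"
  shows "h = h'"
proof -
  have "Cmp C Z Q A p h \<in> Hom C Z A" "Cmp C Z Q B q h \<in> Hom C Z B"
    using assms by (auto simp: is_product_def)
  then have "\<exists>!k. k \<in> Hom C Z Q \<and> Cmp C Z Q A p k = Cmp C Z Q A p h
      \<and> Cmp C Z Q B q k = Cmp C Z Q B q h"
    using assms unfolding is_product_def by blast
  then show ?thesis
    using assms by metis
qed

lemma (in category) terminal_iso:
  assumes "is_terminal C T" "is_terminal C T'"
  obtains i j where "is_inverse C T T' i j"
proof -
  obtain i j where "i \<in> Hom C T T'" "j \<in> Hom C T' T"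
    using assms terminal_ex terminal_Ob by metis
  then have "is_inverse C T T' i j"
    using terminal_Ob[OF assms(1)] terminal_Ob[OF assms(2)]
    by (auto simp: is_inverse_def
        intro: terminal_eq[OF assms(1), of T] terminal_eq[OF assms(2), of T'])
  then show thesis by (rule that)
qed

lemma (in category) product_iso:
  assumes P: "is_product C A B Q p q" and P': "is_product C A B Q' p' q'"
  obtains i j where "is_inverse C Q' Q i j" "Cmp C Q' Q A p i = p'" "Cmp C Q' Q B q i = q'"
proof -
  note [simp] = product_Ob[OF P] product_Hom[OF P] product_Ob[OF P'] product_Hom[OF P']
  obtain i where i: "i \<in> Hom C Q' Q" "Cmp C Q' Q A p i = p'" "Cmp C Q' Q B q i = q'"
    using product_ex[OF P, of Q' p' q'] by auto
  obtain j where j: "j \<in> Hom C Q Q'" "Cmp C Q Q' A p' j = p" "Cmp C Q Q' B q' j = q"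
    using product_ex[OF P', of Q p q] by auto
  have "Cmp C Q Q' Q i j = Idn C Q"
    by (rule product_eqI[OF P, of Q])
      (simp_all add: i j Cmp_assoc[of Q Q' Q A j i p] Cmp_assoc[of Q Q' Q B j i q] del: Cmp_reassoc)
  moreover have "Cmp C Q' Q Q' j i = Idn C Q'"
    by (rule product_eqI[OF P', of Q'])
      (simp_all add: i j Cmp_assoc[of Q' Q Q' A i j p'] Cmp_assoc[of Q' Q Q' B i j q']
        del: Cmp_reassoc)
  ultimately show thesis
    using i j that[of i j] by (auto simp: is_inverse_def)
qed

lemma (in category) terminal_transport:
  assumes T: "is_terminal C T" and T': "T' \<in> Ob C" and ij: "is_inverse C T' T i j"
  shows "is_terminal C T'"
  unfolding is_terminal_def
proof (intro conjI ballI T')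
  have ij': "i \<in> Hom C T' T" "j \<in> Hom C T T'" "Cmp C T' T T' j i = Idn C T'"
    using ij by (auto simp: is_inverse_def)
  fix A assume A: "A \<in> Ob C"
  obtain f where f: "f \<in> Hom C A T" using terminal_ex[OF T A] by blast
  show "\<exists>!f. f \<in> Hom C A T'"
  proof (rule ex1I)
    show "Cmp C A T T' j f \<in> Hom C A T'"
      using A T' terminal_Ob[OF T] ij' f by simp
    fix g assume g: "g \<in> Hom C A T'"
    have "f = Cmp C A T' T i g"
      using A T' terminal_Ob[OF T] ij' f g by (intro terminal_eq[OF T]) auto
    then show "g = Cmp C A T T' j f"
      using A T' terminal_Ob[OF T] ij' g by (simp add: Cmp_assoc del: Cmp_reassoc)
  qed
qed

lemma (in category) product_transport:
  assumes P: "is_product C A B Q p q" and Q': "Q' \<in> Ob C" and ij: "is_inverse C Q' Q i j"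
  shows "is_product C A B Q' (Cmp C Q' Q A p i) (Cmp C Q' Q B q i)"
proof -
  note [simp] = product_Ob[OF P] product_Hom[OF P] Q'
  have ij' [simp]: "i \<in> Hom C Q' Q" "j \<in> Hom C Q Q'" "Cmp C Q Q' Q i j = Idn C Q"
    and ji: "Cmp C Q' Q Q' j i = Idn C Q'"
    using ij by (auto simp: is_inverse_def)
  have "\<exists>!h. h \<in> Hom C Z Q' \<and> Cmp C Z Q' A (Cmp C Q' Q A p i) h = f
      \<and> Cmp C Z Q' B (Cmp C Q' Q B q i) h = g"
    if Z: "Z \<in> Ob C" and f: "f \<in> Hom C Z A" and g: "g \<in> Hom C Z B" for Z f g
  proof -
    obtain h where h: "h \<in> Hom C Z Q" "Cmp C Z Q A p h = f" "Cmp C Z Q B q h = g"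
      using product_ex[OF P Z f g] by blast
    have ijh: "Cmp C Z Q' Q i (Cmp C Z Q Q' j h) = h"
      using Cmp_assoc[of Z Q Q' Q h j i] h(1) Z by (simp del: Cmp_reassoc)
    show ?thesis
    proof (rule ex1I)
      show "Cmp C Z Q Q' j h \<in> Hom C Z Q' \<and>
          Cmp C Z Q' A (Cmp C Q' Q A p i) (Cmp C Z Q Q' j h) = f \<and>
          Cmp C Z Q' B (Cmp C Q' Q B q i) (Cmp C Z Q Q' j h) = g"
        using Z h by (simp add: ijh)
    next
      fix k assume k: "k \<in> Hom C Z Q' \<and> Cmp C Z Q' A (Cmp C Q' Q A p i) k = f \<and>
          Cmp C Z Q' B (Cmp C Q' Q B q i) k = g"
      then have k: "k \<in> Hom C Z Q'"
        and "Cmp C Z Q' A (Cmp C Q' Q A p i) k = f" "Cmp C Z Q' B (Cmp C Q' Q B q i) k = g"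
        by blast+
      then have "Cmp C Z Q' Q i k = h"
        using Z h by - (rule product_eqI[OF P Z], simp_all)
      then show "k = Cmp C Z Q Q' j h"
        using Cmp_assoc[of Z Q' Q Q' k i j] Z k ji by (simp del: Cmp_reassoc)
    qed
  qed
  then show ?thesis by (simp add: is_product_def)
qed

lemma functor_is_inverse:
  assumes F: "is_functor C D F" and AB: "A \<in> Ob C" "B \<in> Ob C" and fg: "is_inverse C A B f g"
  shows "is_inverse D (Fob F A) (Fob F B) (Farr F A B f) (Farr F B A g)"
  using fg AB Farr_Cmp[OF F, of A B A f g] Farr_Cmp[OF F, of B A B g f]
  by (simp add: is_inverse_def functor_simps(1-3)[OF F])

section \<open>Calculus of tuples and projections\<close>

context fp_category
begin

lemma Trm_Ob [simp]: "Trm C \<in> Ob C"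
  by (rule terminal_Ob[OF Trm_terminal])

lemma Prd_simps [simp]:
  assumes "A \<in> Ob C" "B \<in> Ob C"
  shows "Prd C A B \<in> Ob C" "Pr1 C A B \<in> Hom C (Prd C A B) A" "Pr2 C A B \<in> Hom C (Prd C A B) B"
  using Prd_product[OF assms] by (auto simp: is_product_def)

lemma bang_Hom [simp]: "A \<in> Ob C \<Longrightarrow> bang C A (Trm C) \<in> Hom C A (Trm C)"
  unfolding bang_def by (rule theI') (use Trm_terminal in \<open>auto simp: is_terminal_def\<close>)

lemma tuple_simps [simp]:
  assumes "Z \<in> Ob C" "A \<in> Ob C" "B \<in> Ob C" "f \<in> Hom C Z A" "g \<in> Hom C Z B"
  shows "tuple C Z A B f g \<in> Hom C Z (Prd C A B)"
    and "Cmp C Z (Prd C A B) A (Pr1 C A B) (tuple C Z A B f g) = f"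
    and "Cmp C Z (Prd C A B) B (Pr2 C A B) (tuple C Z A B f g) = g"
proof -
  have "\<exists>!h. h \<in> Hom C Z (Prd C A B)
        \<and> Cmp C Z (Prd C A B) A (Pr1 C A B) h = f
        \<and> Cmp C Z (Prd C A B) B (Pr2 C A B) h = g"
    using Prd_product[OF assms(2,3)] assms unfolding is_product_def by blast
  from theI'[OF this]
  show "tuple C Z A B f g \<in> Hom C Z (Prd C A B)"
    and "Cmp C Z (Prd C A B) A (Pr1 C A B) (tuple C Z A B f g) = f"
    and "Cmp C Z (Prd C A B) B (Pr2 C A B) (tuple C Z A B f g) = g"
    unfolding tuple_def by blast+
qed

lemma Prd_eqI:
  assumes "Cmp C Z (Prd C A B) A (Pr1 C A B) h = Cmp C Z (Prd C A B) A (Pr1 C A B) h'"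
    and "Cmp C Z (Prd C A B) B (Pr2 C A B) h = Cmp C Z (Prd C A B) B (Pr2 C A B) h'"
    and "Z \<in> Ob C" "A \<in> Ob C" "B \<in> Ob C" "h \<in> Hom C Z (Prd C A B)" "h' \<in> Hom C Z (Prd C A B)"
  shows "h = h'"
  using product_eqI[OF Prd_product] assms by blast

text \<open>Right nesting hides a projection of a tuple behind a further composite; this is the
  projection law in that shape.\<close>

lemma Pr_tuple_Cmp [simp]:
  assumes "Z \<in> Ob C" "W \<in> Ob C" "A \<in> Ob C" "B \<in> Ob C"
    and "f \<in> Hom C Z A" "g \<in> Hom C Z B" "k \<in> Hom C W Z"
  shows "Cmp C W (Prd C A B) A (Pr1 C A B) (Cmp C W Z (Prd C A B) (tuple C Z A B f g) k)
      = Cmp C W Z A f k"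
    and "Cmp C W (Prd C A B) B (Pr2 C A B) (Cmp C W Z (Prd C A B) (tuple C Z A B f g) k)
      = Cmp C W Z B g k"
  using assms by (simp_all add: Cmp_assoc del: Cmp_reassoc)

text \<open>Together with the projection laws and \<open>tuple_eta\<close> this normalises arrows
  into products, so that the category laws of the Kleisli category become pure rewriting.\<close>

lemma tuple_Cmp [simp]:
  assumes "Z \<in> Ob C" "W \<in> Ob C" "A \<in> Ob C" "B \<in> Ob C"
    and "f \<in> Hom C Z A" "g \<in> Hom C Z B" "k \<in> Hom C W Z"
  shows "Cmp C W Z (Prd C A B) (tuple C Z A B f g) k
      = tuple C W A B (Cmp C W Z A f k) (Cmp C W Z B g k)"
  using assms by - (rule Prd_eqI[of W A B], simp_all)

lemma tuple_eta [simp]: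
  "\<lbrakk>A \<in> Ob C; B \<in> Ob C\<rbrakk> \<Longrightarrow> tuple C (Prd C A B) A B (Pr1 C A B) (Pr2 C A B) = Idn C (Prd C A B)"
  by (rule Prd_eqI[of "Prd C A B" A B]) simp_all

lemma Trm_eqI: "\<lbrakk>A \<in> Ob C; f \<in> Hom C A (Trm C); g \<in> Hom C A (Trm C)\<rbrakk> \<Longrightarrow> f = g"
  by (rule terminal_eq[OF Trm_terminal])

text \<open>Any terminal object or product cone is isomorphic to the chosen one. The functor
  preserves this isomorphism, and being terminal or a product cone is transported along isomorphisms
  in D.\<close>

lemma preserves_fp_if_chosen:
  assumes F: "is_functor C D F"
    and T: "is_terminal D (Fob F (Trm C))"
    and Q: "\<And>A B. \<lbrakk>A \<in> Ob C; B \<in> Ob C\<rbrakk> \<Longrightarrow>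
      is_product D (Fob F A) (Fob F B) (Fob F (Prd C A B))
        (Farr F (Prd C A B) A (Pr1 C A B)) (Farr F (Prd C A B) B (Pr2 C A B))"
  shows "preserves_fp C D F"
  unfolding preserves_fp_def
proof (intro conjI allI impI)
  interpret D: category D by (rule is_functor_cod[OF F])
  show "is_terminal D (Fob F S)" if S: "is_terminal C S" for S
  proof -
    obtain i j where "is_inverse C S (Trm C) i j"
      using terminal_iso[OF S Trm_terminal] by blast
    from functor_is_inverse[OF F _ _ this] show ?thesis
      using D.terminal_transport[OF T] S by (simp add: terminal_Ob Fob_Ob[OF F])
  qed
  show "is_product D (Fob F A) (Fob F B) (Fob F S) (Farr F S A p) (Farr F S B q)"
    if S: "is_product C A B S p q" for A B S p q
  proof -
    note [simp] = product_Ob[OF S]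
    obtain i j where ij: "is_inverse C S (Prd C A B) i j"
      "Cmp C S (Prd C A B) A (Pr1 C A B) i = p" "Cmp C S (Prd C A B) B (Pr2 C A B) i = q"
      using product_iso[OF Prd_product S] by auto
    have "i \<in> Hom C S (Prd C A B)" using ij(1) by (simp add: is_inverse_def)
    then show ?thesis
      using D.product_transport[OF Q Fob_Ob[OF F] functor_is_inverse[OF F _ _ ij(1)]]
      by (simp add: functor_simps[OF F] flip: ij(2,3))
  qed
qed

end

lemma preserves_fp_comp_func:
  assumes F: "preserves_fp C D F" and G: "preserves_fp D E G"
  shows "preserves_fp C E (comp_func C G F)"
  unfolding preserves_fp_def
proof (intro conjI allI impI)
  fix T assume T: "is_terminal C T"
  then have "is_terminal E (Fob G (Fob F T))"
    using F G by (simp add: preserves_fp_def)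
  then show "is_terminal E (Fob (comp_func C G F) T)"
    using terminal_Ob[OF T] by (simp add: comp_func_def)
next
  fix A B Q p q assume Q: "is_product C A B Q p q"
  then have "is_product E (Fob G (Fob F A)) (Fob G (Fob F B)) (Fob G (Fob F Q))
      (Farr G (Fob F Q) (Fob F A) (Farr F Q A p)) (Farr G (Fob F Q) (Fob F B) (Farr F Q B q))"
    using F G by (simp add: preserves_fp_def)
  then show "is_product E (Fob (comp_func C G F) A) (Fob (comp_func C G F) B)
      (Fob (comp_func C G F) Q) (Farr (comp_func C G F) Q A p) (Farr (comp_func C G F) Q B q)"
    using product_Ob[OF Q] product_Hom[OF Q] by (simp add: comp_func_def)
qed

section \<open>Primary doctrines and their 1-arrows\<close>

locale finite_meets = lower_semilattice + weak_partial_order_top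

lemma has_finite_meets_iff: "has_finite_meets L \<longleftrightarrow> finite_meets L"
  by (simp add: has_finite_meets_def finite_meets_def)

context finite_meets
begin

lemma meet_eqI:
  assumes "z \<in> carrier L" "z \<sqsubseteq> x" "z \<sqsubseteq> y" "x \<in> carrier L" "y \<in> carrier L"
    and "\<And>w. \<lbrakk>w \<in> carrier L; w \<sqsubseteq> x; w \<sqsubseteq> y\<rbrakk> \<Longrightarrow> w \<sqsubseteq> z"
  shows "x \<sqinter> y = z"
  using assms by (intro le_antisym meet_le) (auto simp: meet_left meet_right)

lemma top_eqI:
  assumes "z \<in> carrier L" "\<And>w. w \<in> carrier L \<Longrightarrow> w \<sqsubseteq> z"
  shows "\<top> = z"
  using assms by (intro le_antisym) auto

lemma top_meet_left [simp]: "x \<in> carrier L \<Longrightarrow> \<top> \<sqinter> x = x"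
  by (rule meet_eqI) auto

lemma meet_absorb: "\<lbrakk>x \<in> carrier L; y \<in> carrier L; y \<sqsubseteq> x\<rbrakk> \<Longrightarrow> x \<sqinter> y = y"
  by (rule meet_eqI) auto

lemma meet_distrib:
  assumes "t \<in> carrier L" "x \<in> carrier L" "y \<in> carrier L"
  shows "t \<sqinter> (x \<sqinter> y) = (t \<sqinter> x) \<sqinter> (t \<sqinter> y)"
  using assms by (intro le_antisym meet_le)
    (auto intro: meet_left meet_right le_trans[OF meet_right meet_left]
      le_trans[OF meet_right meet_right] le_trans[OF meet_left meet_right]
      le_trans[OF meet_left meet_left])

text \<open>A principal down-set is closed under binary meets and inherits the order, so only the
  top changes. With t = P(pr_1)(\<phi>) this describes the fibres of the Kleisli doctrine.\<close>

lemma finite_meets_down: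
  assumes t: "t \<in> carrier L"
  defines "M \<equiv> L\<lparr>carrier := {x \<in> carrier L. x \<sqsubseteq> t}\<rparr>"
  shows "finite_meets M" and "\<top>\<^bsub>M\<^esub> = t"
    and "\<lbrakk>x \<in> carrier M; y \<in> carrier M\<rbrakk> \<Longrightarrow> x \<sqinter>\<^bsub>M\<^esub> y = x \<sqinter> y"
proof -
  have wpo: "weak_partial_order M"
    unfolding M_def by (rule weak_partial_order_subset) (auto intro: weak_partial_order_axioms)
  have top: "greatest M t (carrier M)"
    using t by (auto simp: M_def greatest_def)
  have inf: "greatest M (x \<sqinter> y) (Lower M {x, y})" if "x \<in> carrier M" "y \<in> carrier M" for x y
    using that t le_trans[of "x \<sqinter> y" x t]
    by (auto simp: M_def greatest_def Lower_def meet_left meet_right intro: meet_le)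
  interpret M: weak_partial_order M by (rule wpo)
  interpret M: finite_meets M
    by unfold_locales (use top inf eq_is_equal in \<open>auto simp: M_def\<close>)
  show "finite_meets M" by (rule M.finite_meets_axioms)
  show "\<top>\<^bsub>M\<^esub> = t"
    using t by (intro M.top_eqI) (auto simp: M_def)
  show "x \<sqinter>\<^bsub>M\<^esub> y = x \<sqinter> y" if "x \<in> carrier M" "y \<in> carrier M"
    using inf[OF that] that
    by (intro M.meet_eqI) (auto simp: greatest_def Lower_def M_def)
qed

end

text \<open>The order is recovered from meets: x \<sqsubseteq> y gives y \<sqinter> x = x, an
  equation that h transports. Monotonicity of reindexings and of fibre maps is obtained this way
  below.\<close>

lemma isotone_if_preserves_meets:
  assumes "finite_meets L" "finite_meets M" "h \<in> carrier L \<rightarrow> carrier M"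
    and meet: "\<And>x y. \<lbrakk>x \<in> carrier L; y \<in> carrier L\<rbrakk> \<Longrightarrow> h (x \<sqinter>\<^bsub>L\<^esub> y) = h x \<sqinter>\<^bsub>M\<^esub> h y"
  shows "isotone L M h"
proof -
  interpret L: finite_meets L by fact
  interpret M: finite_meets M by fact
  show ?thesis
  proof (rule isotoneI[OF L.weak_partial_order_axioms M.weak_partial_order_axioms])
    fix x y assume "x \<in> carrier L" "y \<in> carrier L" "x \<sqsubseteq>\<^bsub>L\<^esub> y"
    moreover from this have "h x \<in> carrier M" "h y \<in> carrier M"
      using assms(3) by auto
    ultimately show "h x \<sqsubseteq>\<^bsub>M\<^esub> h y"
      using meet[of y x] M.meet_left[of "h y" "h x"] L.meet_absorb by simp
  qed
qed

section \<open>Fibres and reindexing of a primary doctrine\<close>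

locale primary_doctrine =
  fixes P :: "('o, 'a, 'p) doctrine"
  assumes primary: "is_primary P"
begin

sublocale fp_category "Base P"
  using primary by (simp add: is_primary_def is_doctrine_def)

lemma Fib_finite_meets: "A \<in> Ob (Base P) \<Longrightarrow> finite_meets (Fib P A)"
  using primary by (simp add: is_primary_def has_finite_meets_iff)

lemma Rdx_closed [simp]:
  assumes "A \<in> Ob (Base P)" "B \<in> Ob (Base P)" "f \<in> Hom (Base P) A B" "\<alpha> \<in> carrier (Fib P B)"
  shows "Rdx P A B f \<alpha> \<in> carrier (Fib P A)"
proof -
  have "Rdx P A B f \<in> carrier (Fib P B) \<rightarrow> carrier (Fib P A)"
    using primary assms(1-3) by (simp add: is_primary_def is_doctrine_def)
  then show ?thesis using assms(4) by auto
qed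

lemma Rdx_mono:
  assumes "A \<in> Ob (Base P)" "B \<in> Ob (Base P)" "f \<in> Hom (Base P) A B"
    and "\<alpha> \<in> carrier (Fib P B)" "\<beta> \<in> carrier (Fib P B)" "\<alpha> \<sqsubseteq>\<^bsub>Fib P B\<^esub> \<beta>"
  shows "Rdx P A B f \<alpha> \<sqsubseteq>\<^bsub>Fib P A\<^esub> Rdx P A B f \<beta>"
proof -
  have "isotone (Fib P B) (Fib P A) (Rdx P A B f)"
    using primary assms(1-3) by (simp add: is_primary_def is_doctrine_def)
  then show ?thesis using assms(4-6) by (rule use_iso2)
qed

lemma Rdx_Idn [simp]:
  "\<lbrakk>A \<in> Ob (Base P); \<alpha> \<in> carrier (Fib P A)\<rbrakk> \<Longrightarrow> Rdx P A A (Idn (Base P) A) \<alpha> = \<alpha>"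
  using primary unfolding is_primary_def is_doctrine_def by blast

lemma Rdx_Rdx [simp]:
  "\<lbrakk>A \<in> Ob (Base P); B \<in> Ob (Base P); E \<in> Ob (Base P);
    f \<in> Hom (Base P) A B; g \<in> Hom (Base P) B E; \<alpha> \<in> carrier (Fib P E)\<rbrakk>
    \<Longrightarrow> Rdx P A B f (Rdx P B E g \<alpha>) = Rdx P A E (Cmp (Base P) A B E g f) \<alpha>"
  using primary by (simp add: is_primary_def is_doctrine_def)

lemma Rdx_meet [simp]:
  "\<lbrakk>A \<in> Ob (Base P); B \<in> Ob (Base P); f \<in> Hom (Base P) A B;
    \<alpha> \<in> carrier (Fib P B); \<beta> \<in> carrier (Fib P B)\<rbrakk>
    \<Longrightarrow> Rdx P A B f (\<alpha> \<sqinter>\<^bsub>Fib P B\<^esub> \<beta>) = Rdx P A B f \<alpha> \<sqinter>\<^bsub>Fib P A\<^esub> Rdx P A B f \<beta>"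
  using primary unfolding is_primary_def preserves_finite_meets_def by blast

lemma Rdx_top [simp]:
  "\<lbrakk>A \<in> Ob (Base P); B \<in> Ob (Base P); f \<in> Hom (Base P) A B\<rbrakk>
    \<Longrightarrow> Rdx P A B f \<top>\<^bsub>Fib P B\<^esub> = \<top>\<^bsub>Fib P A\<^esub>"
  using primary unfolding is_primary_def preserves_finite_meets_def by blast

lemma Fib_simps [simp]:
  assumes "A \<in> Ob (Base P)"
  shows Fib_top_closed: "\<top>\<^bsub>Fib P A\<^esub> \<in> carrier (Fib P A)"
    and Fib_meet_closed: "\<lbrakk>\<alpha> \<in> carrier (Fib P A); \<beta> \<in> carrier (Fib P A)\<rbrakk>
      \<Longrightarrow> \<alpha> \<sqinter>\<^bsub>Fib P A\<^esub> \<beta> \<in> carrier (Fib P A)"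
    and Fib_top_meet: "\<alpha> \<in> carrier (Fib P A) \<Longrightarrow> \<top>\<^bsub>Fib P A\<^esub> \<sqinter>\<^bsub>Fib P A\<^esub> \<alpha> = \<alpha>"
    and Fib_refl: "\<alpha> \<in> carrier (Fib P A) \<Longrightarrow> \<alpha> \<sqsubseteq>\<^bsub>Fib P A\<^esub> \<alpha>"
proof -
  interpret finite_meets "Fib P A" by (rule Fib_finite_meets[OF assms])
  show "\<top>\<^bsub>Fib P A\<^esub> \<in> carrier (Fib P A)"
    and "\<lbrakk>\<alpha> \<in> carrier (Fib P A); \<beta> \<in> carrier (Fib P A)\<rbrakk>
      \<Longrightarrow> \<alpha> \<sqinter>\<^bsub>Fib P A\<^esub> \<beta> \<in> carrier (Fib P A)"
    and "\<alpha> \<in> carrier (Fib P A) \<Longrightarrow> \<top>\<^bsub>Fib P A\<^esub> \<sqinter>\<^bsub>Fib P A\<^esub> \<alpha> = \<alpha>"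
    and "\<alpha> \<in> carrier (Fib P A) \<Longrightarrow> \<alpha> \<sqsubseteq>\<^bsub>Fib P A\<^esub> \<alpha>"
    by auto
qed

lemma Fib_trans:
  assumes "A \<in> Ob (Base P)" "\<alpha> \<sqsubseteq>\<^bsub>Fib P A\<^esub> \<beta>" "\<beta> \<sqsubseteq>\<^bsub>Fib P A\<^esub> \<gamma>"
    and "\<alpha> \<in> carrier (Fib P A)" "\<beta> \<in> carrier (Fib P A)" "\<gamma> \<in> carrier (Fib P A)"
  shows "\<alpha> \<sqsubseteq>\<^bsub>Fib P A\<^esub> \<gamma>"
proof -
  interpret finite_meets "Fib P A" by (rule Fib_finite_meets[OF assms(1)])
  show ?thesis using assms le_trans by blast
qed

end

section \<open>Primary 1-arrows\<close>

lemma is_primary_arrow1D: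
  assumes "is_primary_arrow1 P R (F, m)"
  shows arrow1_dom: "primary_doctrine P"
    and arrow1_cod: "primary_doctrine R"
    and arrow1_functor: "is_functor (Base P) (Base R) F"
    and arrow1_fp: "preserves_fp (Base P) (Base R) F"
    and arrow1_ext: "mk_fib P m = m"
    and arrow1_closed: "\<lbrakk>A \<in> Ob (Base P); \<alpha> \<in> carrier (Fib P A)\<rbrakk>
      \<Longrightarrow> m A \<alpha> \<in> carrier (Fib R (Fob F A))"
    and arrow1_Rdx: "\<lbrakk>A \<in> Ob (Base P); B \<in> Ob (Base P); f \<in> Hom (Base P) A B;
      \<alpha> \<in> carrier (Fib P B)\<rbrakk>
      \<Longrightarrow> m A (Rdx P A B f \<alpha>) = Rdx R (Fob F A) (Fob F B) (Farr F A B f) (m B \<alpha>)"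
    and arrow1_top: "A \<in> Ob (Base P) \<Longrightarrow> m A \<top>\<^bsub>Fib P A\<^esub> = \<top>\<^bsub>Fib R (Fob F A)\<^esub>"
    and arrow1_meet: "\<lbrakk>A \<in> Ob (Base P); \<alpha> \<in> carrier (Fib P A); \<beta> \<in> carrier (Fib P A)\<rbrakk>
      \<Longrightarrow> m A (\<alpha> \<sqinter>\<^bsub>Fib P A\<^esub> \<beta>) = m A \<alpha> \<sqinter>\<^bsub>Fib R (Fob F A)\<^esub> m A \<beta>"
proof -
  have prim: "is_primary P" "is_primary R" and arr: "is_arrow1 P R (F, m)"
    and pres: "\<And>A. A \<in> Ob (Base P) \<Longrightarrow> preserves_finite_meets (Fib P A) (Fib R (Fob F A)) (m A)"
    using assms by (auto simp: is_primary_arrow1_def)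
  have arr': "m = mk_fib P m"
    "\<And>A. A \<in> Ob (Base P) \<Longrightarrow> m A \<in> carrier (Fib P A) \<rightarrow> carrier (Fib R (Fob F A))"
    using arr by (auto simp: is_arrow1_def)
  show "primary_doctrine P" "primary_doctrine R"
    using prim by (auto simp: primary_doctrine_def)
  show "is_functor (Base P) (Base R) F" "preserves_fp (Base P) (Base R) F"
    using arr by (auto simp: is_arrow1_def)
  show "mk_fib P m = m" using arr'(1) by simp
  show "\<lbrakk>A \<in> Ob (Base P); \<alpha> \<in> carrier (Fib P A)\<rbrakk> \<Longrightarrow> m A \<alpha> \<in> carrier (Fib R (Fob F A))"
    using arr'(2)[of A] by auto
  show "\<lbrakk>A \<in> Ob (Base P); B \<in> Ob (Base P); f \<in> Hom (Base P) A B; \<alpha> \<in> carrier (Fib P B)\<rbrakk>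
      \<Longrightarrow> m A (Rdx P A B f \<alpha>) = Rdx R (Fob F A) (Fob F B) (Farr F A B f) (m B \<alpha>)"
    using arr by (simp add: is_arrow1_def)
  show "A \<in> Ob (Base P) \<Longrightarrow> m A \<top>\<^bsub>Fib P A\<^esub> = \<top>\<^bsub>Fib R (Fob F A)\<^esub>"
    and "\<lbrakk>A \<in> Ob (Base P); \<alpha> \<in> carrier (Fib P A); \<beta> \<in> carrier (Fib P A)\<rbrakk>
      \<Longrightarrow> m A (\<alpha> \<sqinter>\<^bsub>Fib P A\<^esub> \<beta>) = m A \<alpha> \<sqinter>\<^bsub>Fib R (Fob F A)\<^esub> m A \<beta>"
    using pres by (simp_all add: preserves_finite_meets_def)
qed

text \<open>The premise \<open>meet\<close> supplies monotonicity, and the wrapper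
  \<open>mk_fib\<close> supplies the extensionality clause of \<open>is_arrow1\<close>.\<close>

lemma is_primary_arrow1I:
  assumes P: "primary_doctrine P" and R: "primary_doctrine R"
    and F: "is_functor (Base P) (Base R) F" and fp: "preserves_fp (Base P) (Base R) F"
    and closed: "\<And>A \<alpha>. \<lbrakk>A \<in> Ob (Base P); \<alpha> \<in> carrier (Fib P A)\<rbrakk>
      \<Longrightarrow> m A \<alpha> \<in> carrier (Fib R (Fob F A))"
    and Rdx: "\<And>A B f \<alpha>. \<lbrakk>A \<in> Ob (Base P); B \<in> Ob (Base P); f \<in> Hom (Base P) A B;
      \<alpha> \<in> carrier (Fib P B)\<rbrakk>
      \<Longrightarrow> m A (Rdx P A B f \<alpha>) = Rdx R (Fob F A) (Fob F B) (Farr F A B f) (m B \<alpha>)"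
    and top: "\<And>A. A \<in> Ob (Base P) \<Longrightarrow> m A \<top>\<^bsub>Fib P A\<^esub> = \<top>\<^bsub>Fib R (Fob F A)\<^esub>"
    and meet: "\<And>A \<alpha> \<beta>. \<lbrakk>A \<in> Ob (Base P); \<alpha> \<in> carrier (Fib P A); \<beta> \<in> carrier (Fib P A)\<rbrakk>
      \<Longrightarrow> m A (\<alpha> \<sqinter>\<^bsub>Fib P A\<^esub> \<beta>) = m A \<alpha> \<sqinter>\<^bsub>Fib R (Fob F A)\<^esub> m A \<beta>"
  shows "is_primary_arrow1 P R (F, mk_fib P m)"
proof -
  interpret P: primary_doctrine P by fact
  interpret R: primary_doctrine R by fact
  have "isotone (Fib P A) (Fib R (Fob F A)) (mk_fib P m A)" if "A \<in> Ob (Base P)" for A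
    using that
    by (intro isotone_if_preserves_meets P.Fib_finite_meets R.Fib_finite_meets Fob_Ob[OF F])
      (auto simp: closed meet)
  then show ?thesis
    using assms P.primary R.primary
    by (auto simp: is_primary_arrow1_def is_arrow1_def preserves_finite_meets_def is_primary_def)
qed

lemma is_primary_arrow1_comp:
  assumes M: "is_primary_arrow1 P Q (F, m)" and N: "is_primary_arrow1 Q R (G, n)"
  shows "is_primary_arrow1 P R (comp_arrow1 P (G, n) (F, m))"
proof -
  interpret P: primary_doctrine P by (rule arrow1_dom[OF M])
  note F = arrow1_functor[OF M] and G = arrow1_functor[OF N]
  note simps = functor_simps[OF F] functor_simps[OF G]
    arrow1_closed[OF M] arrow1_Rdx[OF M] arrow1_top[OF M] arrow1_meet[OF M]
    arrow1_closed[OF N] arrow1_Rdx[OF N] arrow1_top[OF N] arrow1_meet[OF N]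
  show ?thesis
    unfolding comp_arrow1_def prod.case
    by (rule is_primary_arrow1I[OF P.primary_doctrine_axioms arrow1_cod[OF N]
          is_functor_comp_func[OF F G] preserves_fp_comp_func[OF arrow1_fp[OF M] arrow1_fp[OF N]]])
      (simp_all add: simps comp_func_def)
qed

section \<open>The categories of 1-arrows and 2-cells\<close>

lemma is_cell2_id:
  assumes M: "is_primary_arrow1 P R M"
  shows "is_cell2 P R M M (id_cell2 P R M)"
proof -
  obtain F m where Mdef: "M = (F, m)" by (cases M)
  note M = M[unfolded Mdef]
  interpret R: primary_doctrine R by (rule arrow1_cod[OF M])
  note F = arrow1_functor[OF M]
  show ?thesis
    using is_nat_trans_Idn[OF F]
    by (simp add: Mdef is_cell2_def id_cell2_def arrow1_closed[OF M] functor_simps[OF F])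
qed

lemma is_cell2_vcomp:
  assumes M: "is_primary_arrow1 P R M" and N: "is_primary_arrow1 P R N"
    and L: "is_primary_arrow1 P R L"
    and \<theta>: "is_cell2 P R M N \<theta>" and \<theta>': "is_cell2 P R N L \<theta>'"
  shows "is_cell2 P R M L (vcomp_cell2 P R M N L \<theta>' \<theta>)"
proof -
  obtain F m G n H k where defs: "M = (F, m)" "N = (G, n)" "L = (H, k)"
    by (cases M, cases N, cases L)
  note M = M[unfolded defs] and N = N[unfolded defs] and L = L[unfolded defs]
  interpret P: primary_doctrine P by (rule arrow1_dom[OF M])
  interpret R: primary_doctrine R by (rule arrow1_cod[OF M])
  have nt: "is_nat_trans (Base P) (Base R) F G \<theta>" "is_nat_trans (Base P) (Base R) G H \<theta>'"
    and le: "\<And>A \<alpha>. \<lbrakk>A \<in> Ob (Base P); \<alpha> \<in> carrier (Fib P A)\<rbrakk> \<Longrightarrow>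
      m A \<alpha> \<sqsubseteq>\<^bsub>Fib R (Fob F A)\<^esub> Rdx R (Fob F A) (Fob G A) (\<theta> A) (n A \<alpha>)"
      "\<And>A \<alpha>. \<lbrakk>A \<in> Ob (Base P); \<alpha> \<in> carrier (Fib P A)\<rbrakk> \<Longrightarrow>
      n A \<alpha> \<sqsubseteq>\<^bsub>Fib R (Fob G A)\<^esub> Rdx R (Fob G A) (Fob H A) (\<theta>' A) (k A \<alpha>)"
    using \<theta> \<theta>' by (auto simp: is_cell2_def defs)
  note simps [simp] = Fob_Ob[OF arrow1_functor[OF M]] Fob_Ob[OF arrow1_functor[OF N]]
    Fob_Ob[OF arrow1_functor[OF L]] nat_trans_Hom[OF nt(1)] nat_trans_Hom[OF nt(2)]
    arrow1_closed[OF M] arrow1_closed[OF N] arrow1_closed[OF L]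
  \<comment> \<open>The second inequality is pulled back along \<theta> A by monotone reindexing and
    then chained with the first.\<close>
  have "m A \<alpha> \<sqsubseteq>\<^bsub>Fib R (Fob F A)\<^esub> Rdx R (Fob F A) (Fob H A)
      (Cmp (Base R) (Fob F A) (Fob G A) (Fob H A) (\<theta>' A) (\<theta> A)) (k A \<alpha>)"
    if "A \<in> Ob (Base P)" "\<alpha> \<in> carrier (Fib P A)" for A \<alpha>
    using that R.Rdx_mono[OF _ _ _ _ _ le(2)[OF that], of "Fob F A" "\<theta> A"]
    by (intro R.Fib_trans[OF _ le(1)[OF that]]) simp_all
  then show ?thesis
    using is_nat_trans_Cmp[OF nt] by (simp add: defs is_cell2_def vcomp_cell2_def)
qed

lemma is_cell2_ext: "is_cell2 P R M N \<theta> \<Longrightarrow> \<theta> \<in> extensional (Ob (Base P))"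
  by (cases M; cases N) (simp add: is_cell2_def is_nat_trans_def)

lemma is_cell2_Hom: "\<lbrakk>is_cell2 P R M N \<theta>; A \<in> Ob (Base P)\<rbrakk>
    \<Longrightarrow> \<theta> A \<in> Hom (Base R) (Fob (fst M) A) (Fob (fst N) A)"
  by (cases M; cases N) (simp add: is_cell2_def is_nat_trans_def)

text \<open>The laws hold pointwise in the base of R. A vertical composite is restricted to
  \<open>Ob (Base P)\<close>, so the unit laws also use that a 2-cell is extensional, while
  associativity compares two families that are already restricted.\<close>

lemma category_PD: "category (PD P R)"
proof
  fix M assume "M \<in> Ob (PD P R)"
  then show "Idn (PD P R) M \<in> Hom (PD P R) M M"
    by (simp add: PD_def is_cell2_id)
next
  fix M N L \<theta> \<theta>'
  assume "M \<in> Ob (PD P R)" "N \<in> Ob (PD P R)" "L \<in> Ob (PD P R)"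
    "\<theta> \<in> Hom (PD P R) M N" "\<theta>' \<in> Hom (PD P R) N L"
  then show "Cmp (PD P R) M N L \<theta>' \<theta> \<in> Hom (PD P R) M L"
    by (simp add: PD_def is_cell2_vcomp)
next
  fix M N \<theta>
  assume a: "M \<in> Ob (PD P R)" "N \<in> Ob (PD P R)" "\<theta> \<in> Hom (PD P R) M N"
  obtain F m G n where d: "M = (F, m)" "N = (G, n)" by (cases M, cases N)
  have M: "is_primary_arrow1 P R (F, m)" and N: "is_primary_arrow1 P R (G, n)"
    and \<theta>: "is_cell2 P R (F, m) (G, n) \<theta>"
    using a by (auto simp: PD_def d)
  interpret R: primary_doctrine R by (rule arrow1_cod[OF M])
  note simps = Fob_Ob[OF arrow1_functor[OF M]] Fob_Ob[OF arrow1_functor[OF N]]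
    is_cell2_Hom[OF \<theta>, simplified] is_cell2_ext[OF \<theta>]
  show "Cmp (PD P R) M N N (Idn (PD P R) N) \<theta> = \<theta>"
    and "Cmp (PD P R) M M N \<theta> (Idn (PD P R) M) = \<theta>"
    by (rule extensionalityI[of _ "Ob (Base P)"];
        simp add: d PD_def vcomp_cell2_def id_cell2_def simps)+
next
  fix M N L K \<theta> \<theta>' \<theta>''
  assume a: "M \<in> Ob (PD P R)" "N \<in> Ob (PD P R)" "L \<in> Ob (PD P R)" "K \<in> Ob (PD P R)"
    "\<theta> \<in> Hom (PD P R) M N" "\<theta>' \<in> Hom (PD P R) N L" "\<theta>'' \<in> Hom (PD P R) L K"
  obtain F m G n H k I l where d: "M = (F, m)" "N = (G, n)" "L = (H, k)" "K = (I, l)"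
    by (cases M, cases N, cases L, cases K)
  have M: "is_primary_arrow1 P R (F, m)" and N: "is_primary_arrow1 P R (G, n)"
    and L: "is_primary_arrow1 P R (H, k)" and K: "is_primary_arrow1 P R (I, l)"
    and \<theta>: "is_cell2 P R (F, m) (G, n) \<theta>" "is_cell2 P R (G, n) (H, k) \<theta>'"
      "is_cell2 P R (H, k) (I, l) \<theta>''"
    using a by (auto simp: PD_def d)
  interpret R: primary_doctrine R by (rule arrow1_cod[OF M])
  note simps = Fob_Ob[OF arrow1_functor[OF M]] Fob_Ob[OF arrow1_functor[OF N]]
    Fob_Ob[OF arrow1_functor[OF L]] Fob_Ob[OF arrow1_functor[OF K]]
    is_cell2_Hom[OF \<theta>(1), simplified] is_cell2_Hom[OF \<theta>(2), simplified]
    is_cell2_Hom[OF \<theta>(3), simplified]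
  show "Cmp (PD P R) M L K \<theta>'' (Cmp (PD P R) M N L \<theta>' \<theta>)
      = Cmp (PD P R) M N K (Cmp (PD P R) N L K \<theta>'' \<theta>') \<theta>"
    by (simp add: d PD_def vcomp_cell2_def simps cong: restrict_cong)
qed

section \<open>1-arrows with a point\<close>

lemma in_Ob_PD_at:
  "(M, c) \<in> Ob (PD_at P X \<phi> R) \<longleftrightarrow>
    M \<in> Ob (PD P R) \<and> c \<in> Hom (Base R) (Trm (Base R)) (Fob (fst M) X) \<and>
    \<top>\<^bsub>Fib R (Trm (Base R))\<^esub>
      \<sqsubseteq>\<^bsub>Fib R (Trm (Base R))\<^esub> Rdx R (Trm (Base R)) (Fob (fst M) X) c (snd M X \<phi>)"
  by (cases M) (simp add: PD_at_def PD_def)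

lemma PD_at_simps:
  "Hom (PD_at P X \<phi> R) (M, c) (N, d) = {\<theta> \<in> Hom (PD P R) M N.
     Cmp (Base R) (Trm (Base R)) (Fob (fst M) X) (Fob (fst N) X) (\<theta> X) c = d}"
  "Idn (PD_at P X \<phi> R) (M, c) = Idn (PD P R) M"
  "Cmp (PD_at P X \<phi> R) (M, c) (N, d) (L, e) = Cmp (PD P R) M N L"
  by (cases M, cases N, auto simp: PD_at_def PD_def)+

text \<open>Identities, composites and their laws are those of \<open>PD P R\<close>. What is new is
  the stability of the point equation, which \<open>unit\<close> and \<open>assoc\<close> give for
  identities and composites.\<close>

lemma category_PD_at:
  assumes R: "is_primary R" and X: "X \<in> Ob (Base P)"
  shows "category (PD_at P X \<phi> R)"
proof -
  interpret R: primary_doctrine R by unfold_locales (rule R)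
  interpret PD: category "PD P R" by (rule category_PD)
  have ob: "Fob F X \<in> Ob (Base R)" if "(F, m) \<in> Ob (PD P R)" for F m
    using that X by (auto simp: PD_def intro!: Fob_Ob[OF arrow1_functor])
  have hom: "\<theta> X \<in> Hom (Base R) (Fob F X) (Fob G X)"
    if "\<theta> \<in> Hom (PD P R) (F, m) (G, n)" for F m G n \<theta>
    using that X is_cell2_Hom[of P R "(F, m)" "(G, n)" \<theta> X] by (simp add: PD_def)
  have idn: "Idn (PD P R) M X = Idn (Base R) (Fob (fst M) X)" for M
    using X by (cases M) (simp add: PD_def id_cell2_def)
  have cmp: "Cmp (PD P R) M N L \<theta>' \<theta> X
      = Cmp (Base R) (Fob (fst M) X) (Fob (fst N) X) (Fob (fst L) X) (\<theta>' X) (\<theta> X)" for M N L \<theta>' \<theta>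
    using X by (cases M, cases N, cases L) (simp add: PD_def vcomp_cell2_def)
  let ?T = "Trm (Base R)"
  have unit: "Cmp (Base R) ?T (Fob F X) (Fob F X) (Idn (Base R) (Fob F X)) c = c"
    if "(F, m) \<in> Ob (PD P R)" "c \<in> Hom (Base R) ?T (Fob F X)" for F m c
    using that(2) ob[OF that(1)] by simp
  have assoc: "Cmp (Base R) ?T (Fob F X) (Fob H X)
        (Cmp (Base R) (Fob F X) (Fob G X) (Fob H X) (\<theta>' X) (\<theta> X)) c
      = Cmp (Base R) ?T (Fob G X) (Fob H X) (\<theta>' X) (Cmp (Base R) ?T (Fob F X) (Fob G X) (\<theta> X) c)"
    if "\<theta> \<in> Hom (PD P R) (F, m) (G, n)" "\<theta>' \<in> Hom (PD P R) (G, n) (H, k)"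
      "(F, m) \<in> Ob (PD P R)" "(G, n) \<in> Ob (PD P R)" "(H, k) \<in> Ob (PD P R)"
      "c \<in> Hom (Base R) ?T (Fob F X)" for F m G n H k \<theta> \<theta>' c
    using that(6) ob[OF that(3)] ob[OF that(4)] ob[OF that(5)] hom[OF that(1)] hom[OF that(2)]
    by simp
  show ?thesis
    by unfold_locales (auto simp: in_Ob_PD_at PD_at_simps idn cmp intro: unit assoc)
qed

section \<open>The Kleisli doctrine\<close>

lemma kleisli_cat_simps [simp]:
  "Ob (kleisli_cat C X) = Ob C"
  "Hom (kleisli_cat C X) A B = Hom C (Prd C X A) B"
  "Idn (kleisli_cat C X) A = Pr2 C X A"
  "Cmp (kleisli_cat C X) A B E h g =
     Cmp C (Prd C X A) (Prd C X B) E h (tuple C (Prd C X A) X B (Pr1 C X A) g)"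
  "Trm (kleisli_cat C X) = Trm C"
  "Prd (kleisli_cat C X) A B = Prd C A B"
  "Pr1 (kleisli_cat C X) A B =
     Cmp C (Prd C X (Prd C A B)) (Prd C A B) A (Pr1 C A B) (Pr2 C X (Prd C A B))"
  "Pr2 (kleisli_cat C X) A B =
     Cmp C (Prd C X (Prd C A B)) (Prd C A B) B (Pr2 C A B) (Pr2 C X (Prd C A B))"
  by (simp_all add: kleisli_cat_def)

lemma kleisli_doctrine_simps [simp]:
  "Base (kleisli_doctrine P X \<phi>) = kleisli_cat (Base P) X"
  "Rdx (kleisli_doctrine P X \<phi>) A B g = Rdx P (Prd (Base P) X A) (Prd (Base P) X B)
     (tuple (Base P) (Prd (Base P) X A) X B (Pr1 (Base P) X A) g)"
  by (simp_all add: kleisli_doctrine_def Let_def)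

locale kleisli = primary_doctrine P for P :: "('o, 'a, 'p) doctrine" +
  fixes X :: 'o and \<phi> :: 'p
  assumes X [simp]: "X \<in> Ob (Base P)"
    and \<phi> [simp]: "\<phi> \<in> carrier (Fib P X)"
begin

abbreviation "C \<equiv> Base P"
abbreviation "C\<^sub>X \<equiv> kleisli_cat C X"
abbreviation "P\<^sub>X \<equiv> kleisli_doctrine P X \<phi>"
abbreviation "pt A \<equiv> Rdx P (Prd C X A) X (Pr1 C X A) \<phi>"

lemma category_kleisli: "category C\<^sub>X"
  by unfold_locales simp_all

text \<open>Following a Kleisli arrow h : Z ~> A x B by a Kleisli projection gives pr_i o h, because
  pr_2 <pr_1, h> = h. So the universal property at Z is that of the base category at X x Z, with the
  same tuples; likewise for the terminal object.\<close>

lemma fp_category_kleisli: "fp_category C\<^sub>X"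
proof -
  interpret K: category "C\<^sub>X" by (rule category_kleisli)
  have "is_terminal C\<^sub>X (Trm C)"
    using Trm_terminal by (simp add: is_terminal_def)
  moreover have "is_product C\<^sub>X A B (Prd C A B) (Pr1 C\<^sub>X A B) (Pr2 C\<^sub>X A B)"
    if "A \<in> Ob C" "B \<in> Ob C" for A B
    unfolding is_product_def
  proof (intro conjI ballI)
    fix Z f g assume "Z \<in> Ob C\<^sub>X" "f \<in> Hom C\<^sub>X Z A" "g \<in> Hom C\<^sub>X Z B"
    then have Z: "Z \<in> Ob C" "f \<in> Hom C (Prd C X Z) A" "g \<in> Hom C (Prd C X Z) B"
      by simp_all
    show "\<exists>!h. h \<in> Hom C\<^sub>X Z (Prd C A B) \<and> Cmp C\<^sub>X Z (Prd C A B) A (Pr1 C\<^sub>X A B) h = f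
        \<and> Cmp C\<^sub>X Z (Prd C A B) B (Pr2 C\<^sub>X A B) h = g"
    proof (rule ex1I)
      show "tuple C (Prd C X Z) A B f g \<in> Hom C\<^sub>X Z (Prd C A B)
          \<and> Cmp C\<^sub>X Z (Prd C A B) A (Pr1 C\<^sub>X A B) (tuple C (Prd C X Z) A B f g) = f
          \<and> Cmp C\<^sub>X Z (Prd C A B) B (Pr2 C\<^sub>X A B) (tuple C (Prd C X Z) A B f g) = g"
        using that Z by simp
      fix h assume h: "h \<in> Hom C\<^sub>X Z (Prd C A B)
          \<and> Cmp C\<^sub>X Z (Prd C A B) A (Pr1 C\<^sub>X A B) h = f
          \<and> Cmp C\<^sub>X Z (Prd C A B) B (Pr2 C\<^sub>X A B) h = g"
      then have h': "h \<in> Hom C (Prd C X Z) (Prd C A B)" by simp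
      have "Cmp C (Prd C X Z) (Prd C A B) A (Pr1 C A B) h = f"
        "Cmp C (Prd C X Z) (Prd C A B) B (Pr2 C A B) h = g"
        using h h' that Z by simp_all
      then show "h = tuple C (Prd C X Z) A B f g"
        using h' that Z by - (rule Prd_eqI[of "Prd C X Z" A B], simp_all)
    qed
  qed (use that in simp_all)
  ultimately show ?thesis
    by unfold_locales simp_all
qed

lemma pt_closed [simp]: "A \<in> Ob C \<Longrightarrow> pt A \<in> carrier (Fib P (Prd C X A))"
  by simp

lemma kleisli_carrier:
  "\<alpha> \<in> carrier (Fib P\<^sub>X A) \<longleftrightarrow> \<alpha> \<in> carrier (Fib P (Prd C X A)) \<and> \<alpha> \<sqsubseteq>\<^bsub>Fib P (Prd C X A)\<^esub> pt A"
  by (simp add: kleisli_doctrine_def Let_def)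

lemma kleisli_le [simp]: "\<alpha> \<sqsubseteq>\<^bsub>Fib P\<^sub>X A\<^esub> \<beta> \<longleftrightarrow> \<alpha> \<sqsubseteq>\<^bsub>Fib P (Prd C X A)\<^esub> \<beta>"
  by (simp add: kleisli_doctrine_def Let_def)

lemma kleisli_Fib:
  assumes "A \<in> Ob C"
  shows kleisli_Fib_finite_meets: "finite_meets (Fib P\<^sub>X A)"
    and kleisli_top: "\<top>\<^bsub>Fib P\<^sub>X A\<^esub> = pt A"
    and kleisli_meet: "\<lbrakk>\<alpha> \<in> carrier (Fib P\<^sub>X A); \<beta> \<in> carrier (Fib P\<^sub>X A)\<rbrakk>
      \<Longrightarrow> \<alpha> \<sqinter>\<^bsub>Fib P\<^sub>X A\<^esub> \<beta> = \<alpha> \<sqinter>\<^bsub>Fib P (Prd C X A)\<^esub> \<beta>"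
proof -
  interpret F: finite_meets "Fib P (Prd C X A)"
    using assms by (intro Fib_finite_meets) simp
  have "Fib P\<^sub>X A = (Fib P (Prd C X A))
      \<lparr>carrier := {\<alpha> \<in> carrier (Fib P (Prd C X A)). \<alpha> \<sqsubseteq>\<^bsub>Fib P (Prd C X A)\<^esub> pt A}\<rparr>"
    by (simp add: kleisli_doctrine_def Let_def)
  then show "finite_meets (Fib P\<^sub>X A)" "\<top>\<^bsub>Fib P\<^sub>X A\<^esub> = pt A"
    "\<lbrakk>\<alpha> \<in> carrier (Fib P\<^sub>X A); \<beta> \<in> carrier (Fib P\<^sub>X A)\<rbrakk>
      \<Longrightarrow> \<alpha> \<sqinter>\<^bsub>Fib P\<^sub>X A\<^esub> \<beta> = \<alpha> \<sqinter>\<^bsub>Fib P (Prd C X A)\<^esub> \<beta>"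
    using F.finite_meets_down[OF pt_closed[OF assms]] by simp_all
qed

text \<open>Since pr_1 <pr_1, g> = pr_1, reindexing along <pr_1, g> sends \<open>pt B\<close> to
  \<open>pt A\<close>. The same equation makes reindexing preserve the top elements of the
  fibres.\<close>

lemma kleisli_Rdx_closed:
  assumes "A \<in> Ob C" "B \<in> Ob C" "g \<in> Hom C (Prd C X A) B" "\<alpha> \<in> carrier (Fib P\<^sub>X B)"
  shows "Rdx P\<^sub>X A B g \<alpha> \<in> carrier (Fib P\<^sub>X A)"
proof -
  let ?t = "tuple C (Prd C X A) X B (Pr1 C X A) g"
  have "Rdx P (Prd C X A) (Prd C X B) ?t \<alpha> \<sqsubseteq>\<^bsub>Fib P (Prd C X A)\<^esub>
      Rdx P (Prd C X A) (Prd C X B) ?t (pt B)"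
    using assms by (intro Rdx_mono) (simp_all add: kleisli_carrier)
  then show ?thesis
    using assms by (simp add: kleisli_carrier)
qed

lemma primary_doctrine_kleisli: "primary_doctrine P\<^sub>X"
proof -
  have iso: "isotone (Fib P\<^sub>X B) (Fib P\<^sub>X A) (Rdx P\<^sub>X A B g)"
    and meets: "preserves_finite_meets (Fib P\<^sub>X B) (Fib P\<^sub>X A) (Rdx P\<^sub>X A B g)"
    if "A \<in> Ob C" "B \<in> Ob C" "g \<in> Hom C (Prd C X A) B" for A B g
  proof -
    have meet: "Rdx P\<^sub>X A B g (\<alpha> \<sqinter>\<^bsub>Fib P\<^sub>X B\<^esub> \<beta>) = Rdx P\<^sub>X A B g \<alpha> \<sqinter>\<^bsub>Fib P\<^sub>X A\<^esub> Rdx P\<^sub>X A B g \<beta>"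
      if "\<alpha> \<in> carrier (Fib P\<^sub>X B)" "\<beta> \<in> carrier (Fib P\<^sub>X B)" for \<alpha> \<beta>
      using that \<open>A \<in> Ob C\<close> \<open>B \<in> Ob C\<close> \<open>g \<in> Hom C (Prd C X A) B\<close>
        kleisli_Rdx_closed[of A B g \<alpha>] kleisli_Rdx_closed[of A B g \<beta>]
      by (simp add: kleisli_meet) (simp add: kleisli_carrier)
    show "isotone (Fib P\<^sub>X B) (Fib P\<^sub>X A) (Rdx P\<^sub>X A B g)"
      using that by (intro isotone_if_preserves_meets kleisli_Fib_finite_meets meet)
        (auto intro: kleisli_Rdx_closed simp del: kleisli_doctrine_simps(2))
    show "preserves_finite_meets (Fib P\<^sub>X B) (Fib P\<^sub>X A) (Rdx P\<^sub>X A B g)"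
      unfolding preserves_finite_meets_def
      by (intro conjI ballI meet) (use that in \<open>simp_all add: kleisli_top\<close>)
  qed
  have "partial_order (Fib P\<^sub>X A)" if "A \<in> Ob C" for A
  proof -
    interpret finite_meets "Fib P\<^sub>X A" by (rule kleisli_Fib_finite_meets[OF that])
    show ?thesis by (rule partial_order_axioms)
  qed
  moreover have "Rdx P\<^sub>X A A (Idn C\<^sub>X A) \<alpha> = \<alpha>" if "A \<in> Ob C" "\<alpha> \<in> carrier (Fib P\<^sub>X A)" for A \<alpha>
    using that by (simp add: kleisli_carrier)
  moreover have "Rdx P\<^sub>X A E (Cmp C\<^sub>X A B E h g) \<alpha> = Rdx P\<^sub>X A B g (Rdx P\<^sub>X B E h \<alpha>)"
    if "A \<in> Ob C" "B \<in> Ob C" "E \<in> Ob C" "g \<in> Hom C (Prd C X A) B" "h \<in> Hom C (Prd C X B) E"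
      "\<alpha> \<in> carrier (Fib P\<^sub>X E)" for A B E g h \<alpha>
    using that by (simp add: kleisli_carrier)
  ultimately show ?thesis
    using iso meets kleisli_Rdx_closed fp_category_kleisli kleisli_Fib_finite_meets
    by (simp add: primary_doctrine_def is_primary_def is_doctrine_def has_finite_meets_iff
        del: kleisli_doctrine_simps(2) kleisli_cat_simps(3,4))
qed

section \<open>The 1-arrow into the Kleisli doctrine\<close>

definition incl_func :: "('o, 'a, 'o, 'a) func" where
  "incl_func = fst (kleisli_arrow1 P X \<phi>)"

definition incl_fib :: "'o \<Rightarrow> 'p \<Rightarrow> 'p" where
  "incl_fib = snd (kleisli_arrow1 P X \<phi>)"

lemma kleisli_arrow1_eq: "kleisli_arrow1 P X \<phi> = (incl_func, incl_fib)"
  by (simp add: incl_func_def incl_fib_def)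

lemma incl_simps [simp]:
  "A \<in> Ob C \<Longrightarrow> Fob incl_func A = A"
  "\<lbrakk>A \<in> Ob C; B \<in> Ob C; f \<in> Hom C A B\<rbrakk>
    \<Longrightarrow> Farr incl_func A B f = Cmp C (Prd C X A) A B f (Pr2 C X A)"
  "\<lbrakk>A \<in> Ob C; \<alpha> \<in> carrier (Fib P A)\<rbrakk>
    \<Longrightarrow> incl_fib A \<alpha> = pt A \<sqinter>\<^bsub>Fib P (Prd C X A)\<^esub> Rdx P (Prd C X A) A (Pr2 C X A) \<alpha>"
  by (simp_all add: incl_func_def incl_fib_def kleisli_arrow1_def Let_def)

lemma is_primary_arrow1_kleisli: "is_primary_arrow1 P P\<^sub>X (incl_func, incl_fib)"
proof -
  let ?F = "mk_func C (\<lambda>A. A) (\<lambda>A B f. Cmp C (Prd C X A) A B f (Pr2 C X A))"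
  let ?m = "\<lambda>A \<alpha>. pt A \<sqinter>\<^bsub>Fib P (Prd C X A)\<^esub> Rdx P (Prd C X A) A (Pr2 C X A) \<alpha>"
  interpret K: primary_doctrine P\<^sub>X by (rule primary_doctrine_kleisli)
  interpret KC: fp_category C\<^sub>X by (rule fp_category_kleisli)
  have F: "is_functor C C\<^sub>X ?F"
    by (rule is_functor_mk_func) (simp_all add: category_axioms category_kleisli)
  \<comment> \<open>The chosen projections of the Kleisli category are by construction the images
    under F_X of those of the base, so chosen cones go to chosen cones.\<close>
  have fp: "preserves_fp C C\<^sub>X ?F"
    using KC.Trm_terminal KC.Prd_product by (intro preserves_fp_if_chosen[OF F]) simp_all
  have closed: "?m A \<alpha> \<in> carrier (Fib P\<^sub>X A)" if A: "A \<in> Ob C" "\<alpha> \<in> carrier (Fib P A)" for A \<alpha>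
  proof -
    interpret F: finite_meets "Fib P (Prd C X A)"
      using A by (intro Fib_finite_meets) simp
    show ?thesis using A by (simp add: kleisli_carrier F.meet_left)
  qed
  have closed': "?m A \<alpha> \<in> carrier (Fib P\<^sub>X (Fob ?F A))" if "A \<in> Ob C" "\<alpha> \<in> carrier (Fib P A)" for A \<alpha>
    using closed[OF that] that by simp
  \<comment> \<open>The conjunct \<open>pt A\<close> is duplicated by idempotence of meets, and
    meets in the fibre of the Kleisli doctrine are computed in P(X x A).\<close>
  have meet: "?m A (\<alpha> \<sqinter>\<^bsub>Fib P A\<^esub> \<beta>) = ?m A \<alpha> \<sqinter>\<^bsub>Fib P\<^sub>X (Fob ?F A)\<^esub> ?m A \<beta>"
    if A: "A \<in> Ob C" "\<alpha> \<in> carrier (Fib P A)" "\<beta> \<in> carrier (Fib P A)" for A \<alpha> \<beta>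
  proof -
    interpret F: finite_meets "Fib P (Prd C X A)"
      using A by (intro Fib_finite_meets) simp
    show ?thesis
      using A closed[of A \<alpha>] closed[of A \<beta>] F.meet_distrib[of "pt A"
        "Rdx P (Prd C X A) A (Pr2 C X A) \<alpha>" "Rdx P (Prd C X A) A (Pr2 C X A) \<beta>"]
      by (simp add: kleisli_meet)
  qed
  have top: "?m A \<top>\<^bsub>Fib P A\<^esub> = \<top>\<^bsub>Fib P\<^sub>X (Fob ?F A)\<^esub>" if A: "A \<in> Ob C" for A
  proof -
    interpret F: finite_meets "Fib P (Prd C X A)"
      using A by (intro Fib_finite_meets) simp
    show ?thesis
      using A F.meet_eqI[of "pt A" "pt A" "\<top>\<^bsub>Fib P (Prd C X A)\<^esub>"] by (simp add: kleisli_top)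
  qed
  have "is_primary_arrow1 P P\<^sub>X (?F, mk_fib P ?m)"
    by (rule is_primary_arrow1I[OF primary_doctrine_axioms primary_doctrine_kleisli _ _
          closed' _ top meet]) (use F fp in simp_all)
  then show ?thesis
    by (simp add: incl_func_def incl_fib_def kleisli_arrow1_def Let_def)
qed

end

section \<open>1-arrows out of the Kleisli doctrine\<close>

text \<open>An inverse exists because both objects are terminal, and inverses are unique; hence the
  description in \<open>generic_point\<close> denotes one.\<close>

lemma (in fp_category) is_inverse_bang:
  assumes T: "is_terminal C T"
  shows "is_inverse C T (Trm C) (bang C T (Trm C)) (THE i. is_inverse C T (Trm C) (bang C T (Trm C)) i)"
proof (rule theI')
  obtain i j where ij: "is_inverse C T (Trm C) i j"
    using terminal_iso[OF T Trm_terminal] by blast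
  moreover have "i = bang C T (Trm C)"
    using ij terminal_Ob[OF T] by (intro Trm_eqI[of T]) (simp_all add: is_inverse_def)
  ultimately show "\<exists>!i. is_inverse C T (Trm C) (bang C T (Trm C)) i"
    using is_inverse_unique[OF terminal_Ob[OF T] Trm_Ob] by blast
qed

text \<open>Here \<alpha> is read as an element of P at the object X x A. Reindexing along <pr_1,
  id> cancels pr_2 and turns \<open>pt (Prd C X A)\<close> into \<open>pt A\<close>, leaving the
  meet of \<open>pt A\<close> and \<alpha>, which is \<alpha> because \<alpha> lies below
  \<open>pt A\<close>.\<close>

lemma (in kleisli) kleisli_Fib_decompose:
  assumes A: "A \<in> Ob C" and \<alpha>: "\<alpha> \<in> carrier (Fib P\<^sub>X A)"
  shows "Rdx P\<^sub>X A (Prd C X A) (Idn C (Prd C X A)) (incl_fib (Prd C X A) \<alpha>) = \<alpha>"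
proof -
  interpret F: finite_meets "Fib P (Prd C X A)"
    using A by (intro Fib_finite_meets) simp
  show ?thesis
    using A \<alpha> F.meet_absorb[of "pt A" \<alpha>] by (simp add: kleisli_carrier)
qed

locale kleisli_1arrow = kleisli P X \<phi> + R: primary_doctrine R
  for P :: "('o, 'a, 'p) doctrine" and X \<phi> and R :: "('u, 'b, 'q) doctrine" +
  fixes K :: "('o, 'a, 'u, 'b) func" and k :: "'o \<Rightarrow> 'p \<Rightarrow> 'q"
  assumes arr: "is_primary_arrow1 P\<^sub>X R (K, k)"
begin

abbreviation "D \<equiv> Base R"
abbreviation "tD \<equiv> Trm (Base R)"

lemmas K_functor = arrow1_functor[OF arr, simplified]

text \<open>The composition law is oriented so as to merge images into the image of one Kleisli
  arrow. It is withdrawn wherever a factorisation has to stay visible.\<close>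

lemma K_simps [simp]:
  "A \<in> Ob C \<Longrightarrow> Fob K A \<in> Ob D"
  "\<lbrakk>A \<in> Ob C; B \<in> Ob C; f \<in> Hom C (Prd C X A) B\<rbrakk> \<Longrightarrow> Farr K A B f \<in> Hom D (Fob K A) (Fob K B)"
  "A \<in> Ob C \<Longrightarrow> Farr K A A (Pr2 C X A) = Idn D (Fob K A)"
  "\<lbrakk>A \<in> Ob C; B \<in> Ob C; E \<in> Ob C; f \<in> Hom C (Prd C X A) B; g \<in> Hom C (Prd C X B) E\<rbrakk>
   \<Longrightarrow> Cmp D (Fob K A) (Fob K B) (Fob K E) (Farr K B E g) (Farr K A B f)
     = Farr K A E (Cmp C (Prd C X A) (Prd C X B) E g (tuple C (Prd C X A) X B (Pr1 C X A) f))"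
  using functor_simps[OF K_functor] by simp_all

lemma k_simps [simp]:
  "\<lbrakk>A \<in> Ob C; \<alpha> \<in> carrier (Fib P\<^sub>X A)\<rbrakk> \<Longrightarrow> k A \<alpha> \<in> carrier (Fib R (Fob K A))"
  "A \<in> Ob C \<Longrightarrow> k A (pt A) = \<top>\<^bsub>Fib R (Fob K A)\<^esub>"
  using arrow1_closed[OF arr] arrow1_top[OF arr] by (simp_all add: kleisli_top)

lemma incl_fib_closed [simp]:
  "\<lbrakk>A \<in> Ob C; \<alpha> \<in> carrier (Fib P A)\<rbrakk> \<Longrightarrow> incl_fib A \<alpha> \<in> carrier (Fib P\<^sub>X A)"
  using arrow1_closed[OF is_primary_arrow1_kleisli] by simp

definition res_func :: "('o, 'a, 'u, 'b) func" where
  "res_func = comp_func C K incl_func"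

definition res_fib :: "'o \<Rightarrow> 'p \<Rightarrow> 'q" where
  "res_fib = mk_fib P (\<lambda>A \<alpha>. k (Fob incl_func A) (incl_fib A \<alpha>))"

lemma comp_arrow1_eq: "comp_arrow1 P (K, k) (kleisli_arrow1 P X \<phi>) = (res_func, res_fib)"
  by (simp add: kleisli_arrow1_eq comp_arrow1_def res_func_def res_fib_def)

lemma res_simps [simp]:
  "A \<in> Ob C \<Longrightarrow> Fob res_func A = Fob K A"
  "\<lbrakk>A \<in> Ob C; B \<in> Ob C; f \<in> Hom C A B\<rbrakk>
    \<Longrightarrow> Farr res_func A B f = Farr K A B (Cmp C (Prd C X A) A B f (Pr2 C X A))"
  "\<lbrakk>A \<in> Ob C; \<alpha> \<in> carrier (Fib P A)\<rbrakk> \<Longrightarrow> res_fib A \<alpha> = k A (incl_fib A \<alpha>)"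
  by (simp_all add: res_func_def res_fib_def comp_func_def)

lemma is_primary_arrow1_res: "is_primary_arrow1 P R (res_func, res_fib)"
  using is_primary_arrow1_comp[OF is_primary_arrow1_kleisli arr]
  by (simp add: comp_arrow1_def res_func_def res_fib_def)

abbreviation "gp \<equiv> generic_point C D X K"
abbreviation "tinv \<equiv> THE i. is_inverse D (Fob K (Trm C)) tD (bang D (Fob K (Trm C)) tD) i"

lemma K_Trm: "is_terminal D (Fob K (Trm C))"
  using arrow1_fp[OF arr] fp_category.Trm_terminal[OF fp_category_kleisli]
  by (simp add: preserves_fp_def)

lemma tinv [simp]:
  "tinv \<in> Hom D tD (Fob K (Trm C))"
  "Cmp D (Fob K (Trm C)) tD (Fob K (Trm C)) tinv (bang D (Fob K (Trm C)) tD)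
    = Idn D (Fob K (Trm C))"
  using R.is_inverse_bang[OF K_Trm] by (simp_all add: is_inverse_def)

lemma gp_eq: "gp = Cmp D tD (Fob K (Trm C)) (Fob K X) (Farr K (Trm C) X (Pr1 C X (Trm C))) tinv"
  by (simp add: generic_point_def)

lemma gp_Hom [simp]: "gp \<in> Hom D tD (Fob K X)"
  by (simp add: gp_eq)

text \<open>Cancels the transport along K(t) -> t; this is what turns an equation between generic
  points back into a statement about K(id_X).\<close>

lemma gp_bang: "Cmp D (Fob K (Trm C)) tD (Fob K X) gp (bang D (Fob K (Trm C)) tD)
    = Farr K (Trm C) X (Pr1 C X (Trm C))"
  by (simp add: gp_eq)

text \<open>Over t, the arrow id_X reindexes along <pr_1, pr_1>, which sends both conjuncts of
  f_X(\<phi>) to P(pr_1)(\<phi>). That is the top of the fibre over t, and k preserves it.\<close>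

lemma gp_holds: "Rdx R tD (Fob K X) gp (res_fib X \<phi>) = \<top>\<^bsub>Fib R tD\<^esub>"
proof -
  interpret F: finite_meets "Fib P (Prd C X (Trm C))"
    by (intro Fib_finite_meets) simp
  let ?u = "Pr1 C X (Trm C)"
  have "Rdx R (Fob K (Trm C)) (Fob K X) (Farr K (Trm C) X ?u) (res_fib X \<phi>)
      = k (Trm C) (Rdx P\<^sub>X (Trm C) X ?u (incl_fib X \<phi>))"
    using arrow1_Rdx[OF arr, of "Trm C" X ?u "incl_fib X \<phi>"]
    by (simp del: incl_simps(3) kleisli_doctrine_simps(2))
  also have "Rdx P\<^sub>X (Trm C) X ?u (incl_fib X \<phi>) = pt (Trm C)"
    by (simp add: F.meet_absorb)
  also have "k (Trm C) (pt (Trm C)) = \<top>\<^bsub>Fib R (Fob K (Trm C))\<^esub>"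
    by simp
  finally have top: "Rdx R (Fob K (Trm C)) (Fob K X) (Farr K (Trm C) X ?u) (res_fib X \<phi>)
      = \<top>\<^bsub>Fib R (Fob K (Trm C))\<^esub>" .
  have "Rdx R tD (Fob K X) gp (res_fib X \<phi>) = Rdx R tD (Fob K (Trm C)) tinv
      (Rdx R (Fob K (Trm C)) (Fob K X) (Farr K (Trm C) X ?u) (res_fib X \<phi>))"
    by (simp add: gp_eq del: incl_simps(3))
  also have "\<dots> = \<top>\<^bsub>Fib R tD\<^esub>"
    unfolding top by simp
  finally show ?thesis .
qed

lemma precomp_in_PD_at: "((res_func, res_fib), gp) \<in> Ob (PD_at P X \<phi> R)"
  using is_primary_arrow1_res gp_holds
  by (simp add: in_Ob_PD_at PD_def del: res_simps(3))

text \<open>The projections of this cone are jointly monic, which reduces naturality at eta to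
  naturality at pr_1 and pr_2.\<close>

lemma K_product: "A \<in> Ob C \<Longrightarrow> is_product D (Fob K X) (Fob K A) (Fob K (Prd C X A))
    (Farr K (Prd C X A) X (Cmp C (Prd C X (Prd C X A)) (Prd C X A) X
      (Pr1 C X A) (Pr2 C X (Prd C X A))))
    (Farr K (Prd C X A) A (Cmp C (Prd C X (Prd C X A)) (Prd C X A) A
      (Pr2 C X A) (Pr2 C X (Prd C X A))))"
  using arrow1_fp[OF arr] fp_category.Prd_product[OF fp_category_kleisli, of X A]
  by (simp add: preserves_fp_def)

text \<open>As a Kleisli arrow A ~> X, pr_1 ignores A and so factors through t. Naturality at pr_1
  thus follows from naturality at id_X.\<close>

lemma K_Pr1: "A \<in> Ob C \<Longrightarrow> Farr K A X (Pr1 C X A)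
    = Cmp D (Fob K A) (Fob K (Trm C)) (Fob K X) (Farr K (Trm C) X (Pr1 C X (Trm C)))
        (Farr K A (Trm C) (Cmp C (Prd C X A) A (Trm C) (bang C A (Trm C)) (Pr2 C X A)))"
  by simp

lemma K_decompose: "\<lbrakk>A \<in> Ob C; B \<in> Ob C; g \<in> Hom C (Prd C X A) B\<rbrakk> \<Longrightarrow> Farr K A B g
    = Cmp D (Fob K A) (Fob K (Prd C X A)) (Fob K B)
        (Farr K (Prd C X A) B (Cmp C (Prd C X (Prd C X A)) (Prd C X A) B g (Pr2 C X (Prd C X A))))
        (Farr K A (Prd C X A) (Idn C (Prd C X A)))"
  by simp

end

section \<open>Full faithfulness: comparison of 2-cells\<close>

locale kleisli_1arrow_pair = S: kleisli_1arrow P X \<phi> R K k + T: kleisli_1arrow P X \<phi> R K' k'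
  for P :: "('o, 'a, 'p) doctrine" and X \<phi> and R :: "('u, 'b, 'q) doctrine" and K k K' k'
begin

lemma is_cell2_restrict:
  assumes \<theta>: "is_cell2 S.P\<^sub>X R (K, k) (K', k') \<theta>"
  shows "is_cell2 P R (S.res_func, S.res_fib) (T.res_func, T.res_fib) \<theta>"
    and "Cmp S.D S.tD (Fob K X) (Fob K' X) (\<theta> X) S.gp = T.gp"
proof -
  have nt: "is_nat_trans S.C\<^sub>X S.D K K' \<theta>"
    and le: "\<And>A \<alpha>. \<lbrakk>A \<in> Ob S.C; \<alpha> \<in> carrier (Fib S.P\<^sub>X A)\<rbrakk> \<Longrightarrow>
      k A \<alpha> \<sqsubseteq>\<^bsub>Fib R (Fob K A)\<^esub> Rdx R (Fob K A) (Fob K' A) (\<theta> A) (k' A \<alpha>)"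
    using \<theta> by (simp_all add: is_cell2_def)
  note nts [simp] = nat_trans_Hom[OF nt, simplified]
  \<comment> \<open>The square at f for the restricted functors is the square of \<theta> at f o
    pr_2, and the inequality at \<alpha> is the one at \<open>incl_fib A \<alpha>\<close>.\<close>
  show "is_cell2 P R (S.res_func, S.res_fib) (T.res_func, T.res_fib) \<theta>"
    using arrow1_functor[OF S.is_primary_arrow1_res] arrow1_functor[OF T.is_primary_arrow1_res]
      nat_trans_ext[OF nt] le nat_trans_sq[OF nt]
    by (simp add: is_cell2_def is_nat_trans_def del: S.incl_simps(3))
  have "Cmp S.D S.tD (Fob K X) (Fob K' X) (\<theta> X) S.gp
      = Cmp S.D S.tD (Fob K (Trm S.C)) (Fob K' X) (Cmp S.D (Fob K (Trm S.C)) (Fob K X) (Fob K' X)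
          (\<theta> X) (Farr K (Trm S.C) X (Pr1 S.C X (Trm S.C)))) S.tinv"
    by (simp add: S.gp_eq)
  also have "\<dots> = Cmp S.D S.tD (Fob K' (Trm S.C)) (Fob K' X)
      (Farr K' (Trm S.C) X (Pr1 S.C X (Trm S.C)))
      (Cmp S.D S.tD (Fob K (Trm S.C)) (Fob K' (Trm S.C)) (\<theta> (Trm S.C)) S.tinv)"
    using nat_trans_sq[OF nt, of "Trm S.C" X "Pr1 S.C X (Trm S.C)"] by simp
  \<comment> \<open>Both sides are arrows into K'(t), which is terminal.\<close>
  also have "Cmp S.D S.tD (Fob K (Trm S.C)) (Fob K' (Trm S.C)) (\<theta> (Trm S.C)) S.tinv = T.tinv"
    by (rule terminal_eq[OF T.K_Trm, of S.tD]) simp_all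
  finally show "Cmp S.D S.tD (Fob K X) (Fob K' X) (\<theta> X) S.gp = T.gp"
    by (simp add: T.gp_eq)
qed

text \<open>The Kleisli arrows at which the square of \<theta> commutes are closed under
  composition. They contain the image of F_X by assumption and id_X by the point equation; pr_1,
  then eta, then every arrow is reached from these.\<close>

lemma is_cell2_extend:
  assumes \<theta>: "is_cell2 P R (S.res_func, S.res_fib) (T.res_func, T.res_fib) \<theta>"
    and gp: "Cmp S.D S.tD (Fob K X) (Fob K' X) (\<theta> X) S.gp = T.gp"
  shows "is_cell2 S.P\<^sub>X R (K, k) (K', k') \<theta>"
proof -
  let ?C = "Base P" and ?D = "Base R"
  have nt: "is_nat_trans ?C ?D S.res_func T.res_func \<theta>"
    and le: "\<And>A \<alpha>. \<lbrakk>A \<in> Ob ?C; \<alpha> \<in> carrier (Fib P A)\<rbrakk> \<Longrightarrow>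
      k A (S.incl_fib A \<alpha>) \<sqsubseteq>\<^bsub>Fib R (Fob K A)\<^esub>
        Rdx R (Fob K A) (Fob K' A) (\<theta> A) (k' A (S.incl_fib A \<alpha>))"
    using \<theta> by (simp_all add: is_cell2_def del: S.incl_simps(3))
  have \<theta>_Hom [simp]: "\<theta> A \<in> Hom ?D (Fob K A) (Fob K' A)" if "A \<in> Ob ?C" for A
    using nat_trans_Hom[OF nt that] that by simp
  have sq: "Cmp ?D (Fob K A) (Fob K B) (Fob K' B) (\<theta> B)
        (Farr K A B (Cmp ?C (Prd ?C X A) A B f (Pr2 ?C X A)))
      = Cmp ?D (Fob K A) (Fob K' A) (Fob K' B)
        (Farr K' A B (Cmp ?C (Prd ?C X A) A B f (Pr2 ?C X A))) (\<theta> A)"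
    if "A \<in> Ob ?C" "B \<in> Ob ?C" "f \<in> Hom ?C A B" for A B f
    using nat_trans_sq[OF nt that] that by simp
  let ?t = "Trm ?C" and ?u = "Pr1 ?C X (Trm ?C)"
  \<comment> \<open>The point equation enters here. Precomposing it with K(t) -> t gives the square,
    up to replacing an arrow K(t) -> K'(t) by \<theta> at t.\<close>
  have sq_u: "Cmp ?D (Fob K ?t) (Fob K X) (Fob K' X) (\<theta> X) (Farr K ?t X ?u)
      = Cmp ?D (Fob K ?t) (Fob K' ?t) (Fob K' X) (Farr K' ?t X ?u) (\<theta> ?t)" (is "?l = ?r")
  proof -
    have "?l = Cmp ?D (Fob K ?t) S.tD (Fob K' X)
        (Cmp ?D S.tD (Fob K X) (Fob K' X) (\<theta> X) S.gp) (bang ?D (Fob K ?t) S.tD)"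
      by (simp add: S.gp_bang)
    also have "\<dots> = Cmp ?D (Fob K ?t) (Fob K' ?t) (Fob K' X) (Farr K' ?t X ?u)
        (Cmp ?D (Fob K ?t) S.tD (Fob K' ?t) T.tinv (bang ?D (Fob K ?t) S.tD))"
      unfolding gp by (simp add: T.gp_eq)
    also have "Cmp ?D (Fob K ?t) S.tD (Fob K' ?t) T.tinv (bang ?D (Fob K ?t) S.tD) = \<theta> ?t"
      by (rule terminal_eq[OF T.K_Trm, of "Fob K ?t"]) simp_all
    finally show ?thesis .
  qed
  have sq_Pr1: "Cmp ?D (Fob K A) (Fob K X) (Fob K' X) (\<theta> X) (Farr K A X (Pr1 ?C X A))
      = Cmp ?D (Fob K A) (Fob K' A) (Fob K' X) (Farr K' A X (Pr1 ?C X A)) (\<theta> A)" (is "?l = ?r")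
    if A: "A \<in> Ob ?C" for A
  proof -
    let ?b = "Cmp ?C (Prd ?C X A) A ?t (bang ?C A ?t) (Pr2 ?C X A)"
    have "?l = Cmp ?D (Fob K A) (Fob K ?t) (Fob K' X)
        (Cmp ?D (Fob K ?t) (Fob K X) (Fob K' X) (\<theta> X) (Farr K ?t X ?u)) (Farr K A ?t ?b)"
      unfolding S.K_Pr1[OF A] using A by (simp del: S.K_simps(4))
    also have "\<dots> = Cmp ?D (Fob K A) (Fob K' ?t) (Fob K' X) (Farr K' ?t X ?u)
        (Cmp ?D (Fob K A) (Fob K ?t) (Fob K' ?t) (\<theta> ?t) (Farr K A ?t ?b))"
      unfolding sq_u using A by simp
    also have "\<dots> = Cmp ?D (Fob K A) (Fob K' A) (Fob K' X)
        (Cmp ?D (Fob K' A) (Fob K' ?t) (Fob K' X) (Farr K' ?t X ?u) (Farr K' A ?t ?b)) (\<theta> A)"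
      unfolding sq[OF A S.Trm_Ob S.bang_Hom[OF A]] using A by (simp del: T.K_simps(4))
    also have "\<dots> = ?r"
      unfolding T.K_Pr1[OF A] by (rule refl)
    finally show ?thesis .
  qed
  have sq_eta: "Cmp ?D (Fob K A) (Fob K (Prd ?C X A)) (Fob K' (Prd ?C X A)) (\<theta> (Prd ?C X A))
        (Farr K A (Prd ?C X A) (Idn ?C (Prd ?C X A)))
      = Cmp ?D (Fob K A) (Fob K' A) (Fob K' (Prd ?C X A))
        (Farr K' A (Prd ?C X A) (Idn ?C (Prd ?C X A))) (\<theta> A)"
    if A: "A \<in> Ob ?C" for A
  proof (rule S.R.product_eqI[OF T.K_product[OF A], of "Fob K A"])
    let ?Q = "Prd ?C X A"
    let ?\<eta> = "Idn ?C ?Q"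
    \<comment> \<open>F_X(p) after eta is p itself, now read as a Kleisli arrow A ~> B. So one
      computation covers both projections, given the square at p.\<close>
    have main: "Cmp ?D (Fob K A) (Fob K' ?Q) (Fob K' B)
          (Farr K' ?Q B (Cmp ?C (Prd ?C X ?Q) ?Q B p (Pr2 ?C X ?Q)))
          (Cmp ?D (Fob K A) (Fob K ?Q) (Fob K' ?Q) (\<theta> ?Q) (Farr K A ?Q ?\<eta>))
        = Cmp ?D (Fob K A) (Fob K' ?Q) (Fob K' B)
          (Farr K' ?Q B (Cmp ?C (Prd ?C X ?Q) ?Q B p (Pr2 ?C X ?Q)))
          (Cmp ?D (Fob K A) (Fob K' A) (Fob K' ?Q) (Farr K' A ?Q ?\<eta>) (\<theta> A))" (is "?l = ?r")
      if p: "B \<in> Ob ?C" "p \<in> Hom ?C ?Q B"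
        and eq: "Cmp ?D (Fob K A) (Fob K B) (Fob K' B) (\<theta> B) (Farr K A B p)
          = Cmp ?D (Fob K A) (Fob K' A) (Fob K' B) (Farr K' A B p) (\<theta> A)" for B p
    proof -
      let ?p = "Cmp ?C (Prd ?C X ?Q) ?Q B p (Pr2 ?C X ?Q)"
      have "?l = Cmp ?D (Fob K A) (Fob K ?Q) (Fob K' B) (Cmp ?D (Fob K ?Q) (Fob K' ?Q) (Fob K' B)
          (Farr K' ?Q B ?p) (\<theta> ?Q)) (Farr K A ?Q ?\<eta>)"
        using A p by simp
      also have "\<dots> = Cmp ?D (Fob K A) (Fob K ?Q) (Fob K' B) (Cmp ?D (Fob K ?Q) (Fob K B) (Fob K' B)
          (\<theta> B) (Farr K ?Q B ?p)) (Farr K A ?Q ?\<eta>)"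
        using A p by (simp only: sq S.Prd_simps S.X)
      also have "\<dots> = Cmp ?D (Fob K A) (Fob K B) (Fob K' B) (\<theta> B) (Farr K A B p)"
        using A p by simp
      also have "\<dots> = Cmp ?D (Fob K A) (Fob K' A) (Fob K' B) (Cmp ?D (Fob K' A) (Fob K' ?Q) (Fob K' B)
          (Farr K' ?Q B ?p) (Farr K' A ?Q ?\<eta>)) (\<theta> A)"
        unfolding eq using A p by simp
      also have "\<dots> = ?r"
        using A p by (simp del: T.K_simps(4))
      finally show ?thesis .
    qed
    show "Cmp ?D (Fob K A) (Fob K' ?Q) (Fob K' X)
          (Farr K' ?Q X (Cmp ?C (Prd ?C X ?Q) ?Q X (Pr1 ?C X A) (Pr2 ?C X ?Q)))
          (Cmp ?D (Fob K A) (Fob K ?Q) (Fob K' ?Q) (\<theta> ?Q) (Farr K A ?Q ?\<eta>))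
        = Cmp ?D (Fob K A) (Fob K' ?Q) (Fob K' X)
          (Farr K' ?Q X (Cmp ?C (Prd ?C X ?Q) ?Q X (Pr1 ?C X A) (Pr2 ?C X ?Q)))
          (Cmp ?D (Fob K A) (Fob K' A) (Fob K' ?Q) (Farr K' A ?Q ?\<eta>) (\<theta> A))"
      using A by (intro main sq_Pr1) simp_all
    \<comment> \<open>Here p = pr_2 is the Kleisli identity of A, so the square required by
      \<open>main\<close> is trivial.\<close>
    show "Cmp ?D (Fob K A) (Fob K' ?Q) (Fob K' A)
          (Farr K' ?Q A (Cmp ?C (Prd ?C X ?Q) ?Q A (Pr2 ?C X A) (Pr2 ?C X ?Q)))
          (Cmp ?D (Fob K A) (Fob K ?Q) (Fob K' ?Q) (\<theta> ?Q) (Farr K A ?Q ?\<eta>))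
        = Cmp ?D (Fob K A) (Fob K' ?Q) (Fob K' A)
          (Farr K' ?Q A (Cmp ?C (Prd ?C X ?Q) ?Q A (Pr2 ?C X A) (Pr2 ?C X ?Q)))
          (Cmp ?D (Fob K A) (Fob K' A) (Fob K' ?Q) (Farr K' A ?Q ?\<eta>) (\<theta> A))"
      using A by (intro main) simp_all
  qed (use A in simp_all)
  have "Cmp ?D (Fob K A) (Fob K B) (Fob K' B) (\<theta> B) (Farr K A B g)
      = Cmp ?D (Fob K A) (Fob K' A) (Fob K' B) (Farr K' A B g) (\<theta> A)" (is "?l = ?r")
    if A: "A \<in> Ob ?C" and B: "B \<in> Ob ?C" and g: "g \<in> Hom ?C (Prd ?C X A) B" for A B g
  proof -
    let ?Q = "Prd ?C X A"
    let ?\<eta> = "Idn ?C ?Q" and ?g = "Cmp ?C (Prd ?C X ?Q) ?Q B g (Pr2 ?C X ?Q)"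
    have "?l = Cmp ?D (Fob K A) (Fob K ?Q) (Fob K' B) (Cmp ?D (Fob K ?Q) (Fob K B) (Fob K' B)
        (\<theta> B) (Farr K ?Q B ?g)) (Farr K A ?Q ?\<eta>)"
      unfolding S.K_decompose[OF A B g] using A B g by (simp del: S.K_simps(4))
    also have "\<dots> = Cmp ?D (Fob K A) (Fob K' ?Q) (Fob K' B) (Farr K' ?Q B ?g)
        (Cmp ?D (Fob K A) (Fob K ?Q) (Fob K' ?Q) (\<theta> ?Q) (Farr K A ?Q ?\<eta>))"
      using A B g by (simp add: sq)
    also have "\<dots> = Cmp ?D (Fob K A) (Fob K' A) (Fob K' B) (Cmp ?D (Fob K' A) (Fob K' ?Q) (Fob K' B)
        (Farr K' ?Q B ?g) (Farr K' A ?Q ?\<eta>)) (\<theta> A)"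
      unfolding sq_eta[OF A] using A B g by (simp del: T.K_simps(4))
    also have "\<dots> = ?r"
      unfolding T.K_decompose[OF A B g] by (rule refl)
    finally show ?thesis .
  qed
  moreover have "k A \<alpha> \<sqsubseteq>\<^bsub>Fib R (Fob K A)\<^esub> Rdx R (Fob K A) (Fob K' A) (\<theta> A) (k' A \<alpha>)"
    if A: "A \<in> Ob ?C" and \<alpha>: "\<alpha> \<in> carrier (Fib S.P\<^sub>X A)" for A \<alpha>
  proof -
    let ?Q = "Prd ?C X A"
    let ?\<eta> = "Idn ?C ?Q" and ?i = "S.incl_fib ?Q \<alpha>"
    have \<alpha>' [simp]: "\<alpha> \<in> carrier (Fib P ?Q)"
      using \<alpha> by (simp add: S.kleisli_carrier)
    have i [simp]: "?i \<in> carrier (Fib S.P\<^sub>X ?Q)"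
      using A by (intro S.incl_fib_closed) simp_all
    have "k A \<alpha> = Rdx R (Fob K A) (Fob K ?Q) (Farr K A ?Q ?\<eta>) (k ?Q ?i)"
      using A arrow1_Rdx[OF S.arr, of A ?Q ?\<eta> ?i] S.kleisli_Fib_decompose[OF A \<alpha>]
      by (simp del: S.incl_simps(3) kleisli_doctrine_simps(2))
    also have "\<dots> \<sqsubseteq>\<^bsub>Fib R (Fob K A)\<^esub> Rdx R (Fob K A) (Fob K ?Q) (Farr K A ?Q ?\<eta>)
        (Rdx R (Fob K ?Q) (Fob K' ?Q) (\<theta> ?Q) (k' ?Q ?i))"
      using A le[of ?Q \<alpha>] by (intro S.R.Rdx_mono) (simp_all del: S.incl_simps(3))
    \<comment> \<open>Composite reindexings agree because the square at eta commutes, which moves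
      \<theta> from X x A to A.\<close>
    also have "\<dots> = Rdx R (Fob K A) (Fob K' A) (\<theta> A)
        (Rdx R (Fob K' A) (Fob K' ?Q) (Farr K' A ?Q ?\<eta>) (k' ?Q ?i))"
      using A by (simp add: sq_eta del: S.incl_simps(3))
    also have "Rdx R (Fob K' A) (Fob K' ?Q) (Farr K' A ?Q ?\<eta>) (k' ?Q ?i) = k' A \<alpha>"
      using A arrow1_Rdx[OF T.arr, of A ?Q ?\<eta> ?i] S.kleisli_Fib_decompose[OF A \<alpha>]
      by (simp del: S.incl_simps(3) kleisli_doctrine_simps(2))
    finally show ?thesis .
  qed
  ultimately show ?thesis
    using S.K_functor T.K_functor nat_trans_ext[OF nt]
    by (simp add: is_cell2_def is_nat_trans_def)
qed

end

section \<open>Extending a pointed 1-arrow to the Kleisli doctrine\<close>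

locale kleisli_point = kleisli P X \<phi> + R: primary_doctrine R
  for P :: "('o, 'a, 'p) doctrine" and X \<phi> and R :: "('u, 'b, 'q) doctrine" +
  fixes G :: "('o, 'a, 'u, 'b) func" and g :: "'o \<Rightarrow> 'p \<Rightarrow> 'q" and c :: 'b
  assumes point: "((G, g), c) \<in> Ob (PD_at P X \<phi> R)"
begin

abbreviation "D \<equiv> Base R"
abbreviation "tD \<equiv> Trm (Base R)"

lemma arr: "is_primary_arrow1 P R (G, g)"
  and c_Hom [simp]: "c \<in> Hom D tD (Fob G X)"
  using point by (simp_all add: in_Ob_PD_at PD_def)

lemmas G_functor = arrow1_functor[OF arr]

lemmas G_simps [simp] = Fob_Ob[OF G_functor] Farr_Hom[OF G_functor]

lemma g_simps [simp]:
  "\<lbrakk>A \<in> Ob C; \<alpha> \<in> carrier (Fib P A)\<rbrakk> \<Longrightarrow> g A \<alpha> \<in> carrier (Fib R (Fob G A))"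
  using arrow1_closed[OF arr] .

lemma c_holds: "Rdx R tD (Fob G X) c (g X \<phi>) = \<top>\<^bsub>Fib R tD\<^esub>"
proof -
  interpret F: finite_meets "Fib R tD" by (rule R.Fib_finite_meets) simp
  show ?thesis
    using point by (intro F.le_antisym) (simp_all add: in_Ob_PD_at)
qed

section \<open>The arrow s_A\<close>

definition cst :: "'o \<Rightarrow> 'b" where
  "cst A = Cmp D (Fob G A) tD (Fob G X) c (bang D (Fob G A) tD)"

text \<open>The composite \<open>G(A) \<cong> \<t> \<times> G(A) \<rightarrow> G(X) \<times> G(A) \<cong> G(X \<times> A)\<close>.\<close>
definition sec :: "'o \<Rightarrow> 'b" where
  "sec A = (SOME s. s \<in> Hom D (Fob G A) (Fob G (Prd C X A))
     \<and> Cmp D (Fob G A) (Fob G (Prd C X A)) (Fob G X) (Farr G (Prd C X A) X (Pr1 C X A)) s = cst A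
     \<and> Cmp D (Fob G A) (Fob G (Prd C X A)) (Fob G A) (Farr G (Prd C X A) A (Pr2 C X A)) s
       = Idn D (Fob G A))"

lemma cst_Hom [simp]: "A \<in> Ob C \<Longrightarrow> cst A \<in> Hom D (Fob G A) (Fob G X)"
  by (simp add: cst_def)

lemma cst_Cmp [simp]:
  assumes "A \<in> Ob C" "Z \<in> Ob D" "h \<in> Hom D Z (Fob G A)"
  shows "Cmp D Z (Fob G A) (Fob G X) (cst A) h = Cmp D Z tD (Fob G X) c (bang D Z tD)"
proof -
  have "Cmp D Z (Fob G A) tD (bang D (Fob G A) tD) h = bang D Z tD"
    using assms by (intro R.Trm_eqI[of Z]) simp_all
  then show ?thesis using assms by (simp add: cst_def)
qed

lemma G_product: "A \<in> Ob C \<Longrightarrow> is_product D (Fob G X) (Fob G A) (Fob G (Prd C X A))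
    (Farr G (Prd C X A) X (Pr1 C X A)) (Farr G (Prd C X A) A (Pr2 C X A))"
  using arrow1_fp[OF arr] Prd_product[of X A] by (simp add: preserves_fp_def)

lemma sec [simp]:
  assumes A: "A \<in> Ob C"
  shows "sec A \<in> Hom D (Fob G A) (Fob G (Prd C X A))"
    and "Cmp D (Fob G A) (Fob G (Prd C X A)) (Fob G X) (Farr G (Prd C X A) X (Pr1 C X A)) (sec A)
      = cst A"
    and "Cmp D (Fob G A) (Fob G (Prd C X A)) (Fob G A) (Farr G (Prd C X A) A (Pr2 C X A)) (sec A)
      = Idn D (Fob G A)"
  using someI_ex[OF product_ex[OF G_product[OF A], of "Fob G A" "cst A" "Idn D (Fob G A)"]] A
  unfolding sec_def[symmetric] by simp_all

text \<open>Both sides have first component constant at c and second component G(f) o s_A. The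
  equation yields compatibility with Kleisli composition on arrows and with reindexing on
  fibres.\<close>

lemma sec_natural:
  assumes A: "A \<in> Ob C" and B: "B \<in> Ob C" and f: "f \<in> Hom C (Prd C X A) B"
  shows "Cmp D (Fob G A) (Fob G (Prd C X A)) (Fob G (Prd C X B))
      (Farr G (Prd C X A) (Prd C X B) (tuple C (Prd C X A) X B (Pr1 C X A) f)) (sec A)
    = Cmp D (Fob G A) (Fob G B) (Fob G (Prd C X B)) (sec B)
        (Cmp D (Fob G A) (Fob G (Prd C X A)) (Fob G B) (Farr G (Prd C X A) B f) (sec A))"
    (is "?l = ?r")
proof (rule R.product_eqI[OF G_product[OF B], of "Fob G A"])
  let ?t = "tuple C (Prd C X A) X B (Pr1 C X A) f"
  have pr: "Cmp D (Fob G A) (Fob G (Prd C X B)) (Fob G E) (Farr G (Prd C X B) E p) ?l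
      = Cmp D (Fob G A) (Fob G (Prd C X A)) (Fob G E)
          (Farr G (Prd C X A) E (Cmp C (Prd C X A) (Prd C X B) E p ?t)) (sec A)"
    if "E \<in> Ob C" "p \<in> Hom C (Prd C X B) E" for E p
    using that A B f by (simp add: Farr_Cmp[OF G_functor] del: tuple_Cmp)
  have sec': "Cmp D (Fob G A) (Fob G (Prd C X B)) (Fob G E) (Farr G (Prd C X B) E p) ?r
      = Cmp D (Fob G A) (Fob G B) (Fob G E)
          (Cmp D (Fob G B) (Fob G (Prd C X B)) (Fob G E) (Farr G (Prd C X B) E p) (sec B))
          (Cmp D (Fob G A) (Fob G (Prd C X A)) (Fob G B) (Farr G (Prd C X A) B f) (sec A))"
    if "E \<in> Ob C" "p \<in> Hom C (Prd C X B) E" for E p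
    using that A B f by simp
  show "Cmp D (Fob G A) (Fob G (Prd C X B)) (Fob G X) (Farr G (Prd C X B) X (Pr1 C X B)) ?l
      = Cmp D (Fob G A) (Fob G (Prd C X B)) (Fob G X) (Farr G (Prd C X B) X (Pr1 C X B)) ?r"
    unfolding pr[OF X Prd_simps(2)[OF X B]] sec'[OF X Prd_simps(2)[OF X B]]
    using A B f by (simp del: R.Cmp_reassoc) (simp add: cst_def)
  show "Cmp D (Fob G A) (Fob G (Prd C X B)) (Fob G B) (Farr G (Prd C X B) B (Pr2 C X B)) ?l
      = Cmp D (Fob G A) (Fob G (Prd C X B)) (Fob G B) (Farr G (Prd C X B) B (Pr2 C X B)) ?r"
    unfolding pr[OF B Prd_simps(3)[OF X B]] sec'[OF B Prd_simps(3)[OF X B]]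
    using A B f by (simp del: R.Cmp_reassoc)
qed (use A B f in simp_all)

section \<open>The extended 1-arrow\<close>

definition ext_func :: "('o, 'a, 'u, 'b) func" where
  "ext_func = mk_func C\<^sub>X (Fob G)
     (\<lambda>A B f. Cmp D (Fob G A) (Fob G (Prd C X A)) (Fob G B) (Farr G (Prd C X A) B f) (sec A))"

definition ext_fib :: "'o \<Rightarrow> 'p \<Rightarrow> 'q" where
  "ext_fib = mk_fib P\<^sub>X (\<lambda>A \<alpha>. Rdx R (Fob G A) (Fob G (Prd C X A)) (sec A) (g (Prd C X A) \<alpha>))"

lemma ext_simps [simp]:
  "A \<in> Ob C \<Longrightarrow> Fob ext_func A = Fob G A"
  "\<lbrakk>A \<in> Ob C; B \<in> Ob C; f \<in> Hom C (Prd C X A) B\<rbrakk> \<Longrightarrow> Farr ext_func A B f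
    = Cmp D (Fob G A) (Fob G (Prd C X A)) (Fob G B) (Farr G (Prd C X A) B f) (sec A)"
  "\<lbrakk>A \<in> Ob C; \<alpha> \<in> carrier (Fib P\<^sub>X A)\<rbrakk> \<Longrightarrow> ext_fib A \<alpha>
    = Rdx R (Fob G A) (Fob G (Prd C X A)) (sec A) (g (Prd C X A) \<alpha>)"
  by (simp_all add: ext_func_def ext_fib_def)

text \<open>s_A is a section of G(pr_2). Besides strictness of the restriction this gives
  preservation of products, as the chosen Kleisli projections are images under F_X.\<close>

lemma ext_incl:
  assumes "A \<in> Ob C" "B \<in> Ob C" "f \<in> Hom C A B"
  shows "Farr ext_func A B (Cmp C (Prd C X A) A B f (Pr2 C X A)) = Farr G A B f"
  using assms by (simp add: Farr_Cmp[OF G_functor])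

lemma is_functor_ext_func: "is_functor C\<^sub>X D ext_func"
  unfolding ext_func_def
proof (rule is_functor_mk_func)
  fix A B E f h
  assume "A \<in> Ob C\<^sub>X" "B \<in> Ob C\<^sub>X" "E \<in> Ob C\<^sub>X" "f \<in> Hom C\<^sub>X A B" "h \<in> Hom C\<^sub>X B E"
  then have a: "A \<in> Ob C" "B \<in> Ob C" "E \<in> Ob C" "f \<in> Hom C (Prd C X A) B" "h \<in> Hom C (Prd C X B) E"
    by simp_all
  then show "Cmp D (Fob G A) (Fob G (Prd C X A)) (Fob G E)
        (Farr G (Prd C X A) E (Cmp C\<^sub>X A B E h f)) (sec A)
      = Cmp D (Fob G A) (Fob G B) (Fob G E)
        (Cmp D (Fob G B) (Fob G (Prd C X B)) (Fob G E) (Farr G (Prd C X B) E h) (sec B))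
        (Cmp D (Fob G A) (Fob G (Prd C X A)) (Fob G B) (Farr G (Prd C X A) B f) (sec A))"
    using sec_natural[OF a(1,2,4)] by (simp add: Farr_Cmp[OF G_functor])
qed (simp_all add: category_kleisli R.category_axioms)

lemma preserves_fp_ext_func: "preserves_fp C\<^sub>X D ext_func"
proof (rule fp_category.preserves_fp_if_chosen[OF fp_category_kleisli is_functor_ext_func])
  show "is_terminal D (Fob ext_func (Trm C\<^sub>X))"
    using arrow1_fp[OF arr] Trm_terminal by (simp add: preserves_fp_def)
  fix A B assume "A \<in> Ob C\<^sub>X" "B \<in> Ob C\<^sub>X"
  then have AB: "A \<in> Ob C" "B \<in> Ob C" by simp_all
  have "is_product D (Fob G A) (Fob G B) (Fob G (Prd C A B))
      (Farr G (Prd C A B) A (Pr1 C A B)) (Farr G (Prd C A B) B (Pr2 C A B))"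
    using arrow1_fp[OF arr] Prd_product[OF AB] by (simp add: preserves_fp_def)
  then show "is_product D (Fob ext_func A) (Fob ext_func B) (Fob ext_func (Prd C\<^sub>X A B))
      (Farr ext_func (Prd C\<^sub>X A B) A (Pr1 C\<^sub>X A B)) (Farr ext_func (Prd C\<^sub>X A B) B (Pr2 C\<^sub>X A B))"
    using AB by (simp add: ext_incl del: ext_simps(2))
qed

text \<open>The composite of G(pr_1) with s_A factors through c, so the element is a reindexing of
  R(c)(g_X(\<phi>)), which is top by the condition on the point.\<close>

lemma Rdx_sec_pt:
  assumes A: "A \<in> Ob C"
  shows "Rdx R (Fob G A) (Fob G (Prd C X A)) (sec A) (g (Prd C X A) (pt A)) = \<top>\<^bsub>Fib R (Fob G A)\<^esub>"
proof -
  have "Rdx R (Fob G A) (Fob G (Prd C X A)) (sec A) (g (Prd C X A) (pt A))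
      = Rdx R (Fob G A) (Fob G X) (cst A) (g X \<phi>)"
    using A by (simp add: arrow1_Rdx[OF arr])
  also have "\<dots> = Rdx R (Fob G A) tD (bang D (Fob G A) tD) (Rdx R tD (Fob G X) c (g X \<phi>))"
    using A by (simp add: cst_def)
  also have "\<dots> = \<top>\<^bsub>Fib R (Fob G A)\<^esub>"
    unfolding c_holds using A by simp
  finally show ?thesis .
qed

lemma is_primary_arrow1_ext: "is_primary_arrow1 P\<^sub>X R (ext_func, ext_fib)"
  unfolding ext_fib_def
proof (rule is_primary_arrow1I[OF primary_doctrine_kleisli R.primary_doctrine_axioms])
  show "is_functor (Base P\<^sub>X) D ext_func" "preserves_fp (Base P\<^sub>X) D ext_func"
    using is_functor_ext_func preserves_fp_ext_func by simp_all
  fix A assume "A \<in> Ob (Base P\<^sub>X)"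
  then have A: "A \<in> Ob C" by simp
  show "Rdx R (Fob G A) (Fob G (Prd C X A)) (sec A) (g (Prd C X A) \<top>\<^bsub>Fib P\<^sub>X A\<^esub>)
      = \<top>\<^bsub>Fib R (Fob ext_func A)\<^esub>"
    using Rdx_sec_pt[OF A] A by (simp add: kleisli_top)
  fix \<alpha> assume \<alpha>: "\<alpha> \<in> carrier (Fib P\<^sub>X A)"
  show "Rdx R (Fob G A) (Fob G (Prd C X A)) (sec A) (g (Prd C X A) \<alpha>) \<in> carrier (Fib R (Fob ext_func A))"
    using A \<alpha> by (simp add: kleisli_carrier)
  fix \<beta> assume \<beta>: "\<beta> \<in> carrier (Fib P\<^sub>X A)"
  show "Rdx R (Fob G A) (Fob G (Prd C X A)) (sec A) (g (Prd C X A) (\<alpha> \<sqinter>\<^bsub>Fib P\<^sub>X A\<^esub> \<beta>))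
      = Rdx R (Fob G A) (Fob G (Prd C X A)) (sec A) (g (Prd C X A) \<alpha>)
        \<sqinter>\<^bsub>Fib R (Fob ext_func A)\<^esub> Rdx R (Fob G A) (Fob G (Prd C X A)) (sec A) (g (Prd C X A) \<beta>)"
    using A \<alpha> \<beta> by (simp add: kleisli_meet) (simp add: kleisli_carrier arrow1_meet[OF arr])
next
  fix A B f \<alpha>
  assume "A \<in> Ob (Base P\<^sub>X)" "B \<in> Ob (Base P\<^sub>X)" "f \<in> Hom (Base P\<^sub>X) A B"
    and "\<alpha> \<in> carrier (Fib P\<^sub>X B)"
  then have a: "A \<in> Ob C" "B \<in> Ob C" "f \<in> Hom C (Prd C X A) B"
    and \<alpha>: "\<alpha> \<in> carrier (Fib P (Prd C X B))"
    by (simp_all add: kleisli_carrier)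
  show "Rdx R (Fob G A) (Fob G (Prd C X A)) (sec A) (g (Prd C X A) (Rdx P\<^sub>X A B f \<alpha>))
      = Rdx R (Fob ext_func A) (Fob ext_func B) (Farr ext_func A B f)
          (Rdx R (Fob G B) (Fob G (Prd C X B)) (sec B) (g (Prd C X B) \<alpha>))"
    using a \<alpha> sec_natural[OF a] by (simp add: arrow1_Rdx[OF arr])
qed

sublocale ext: kleisli_1arrow P X \<phi> R ext_func ext_fib
  by unfold_locales (rule is_primary_arrow1_ext)

lemma res_ext_func: "ext.res_func = G"
  by (rule functor_eqI[OF arrow1_functor[OF ext.is_primary_arrow1_res] G_functor])
    (simp_all add: ext_incl del: ext_simps(2))

lemma res_ext_fib: "ext.res_fib = g"
proof -
  have "ext_fib A (incl_fib A \<alpha>) = g A \<alpha>" if A: "A \<in> Ob C" and \<alpha>: "\<alpha> \<in> carrier (Fib P A)" for A \<alpha>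
  proof -
    have "ext_fib A (incl_fib A \<alpha>) = Rdx R (Fob G A) (Fob G (Prd C X A)) (sec A)
        (g (Prd C X A) (pt A) \<sqinter>\<^bsub>Fib R (Fob G (Prd C X A))\<^esub>
         g (Prd C X A) (Rdx P (Prd C X A) A (Pr2 C X A) \<alpha>))"
      using A \<alpha> ext.incl_fib_closed[OF A \<alpha>] by (simp add: arrow1_meet[OF arr] del: Rdx_Rdx)
    \<comment> \<open>The first conjunct becomes top by \<open>Rdx_sec_pt\<close>; the second then
      reduces to g_A(\<alpha>), since G(pr_2) o s_A is the identity.\<close>
    also have "\<dots> = \<top>\<^bsub>Fib R (Fob G A)\<^esub> \<sqinter>\<^bsub>Fib R (Fob G A)\<^esub>
        Rdx R (Fob G A) (Fob G (Prd C X A)) (sec A) (g (Prd C X A) (Rdx P (Prd C X A) A (Pr2 C X A) \<alpha>))"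
      using A \<alpha> Rdx_sec_pt[OF A] by simp
    also have "\<dots> = g A \<alpha>"
      using A \<alpha> by (simp add: arrow1_Rdx[OF arr])
    finally show ?thesis .
  qed
  then have "ext.res_fib = mk_fib P g"
    unfolding ext.res_fib_def by (intro mk_fib_cong) (simp del: incl_simps(3))
  then show ?thesis by (simp add: arrow1_ext[OF arr])
qed

lemma generic_point_ext: "generic_point C D X ext_func = c"
proof -
  \<comment> \<open>The inverse law on this side comes from uniqueness of endomorphisms of the
    terminal object. It cancels the detour through G(t) in c o ! o \<open>ext.tinv\<close>, leaving
    c.\<close>
  have "Cmp D tD (Fob G (Trm C)) tD (bang D (Fob G (Trm C)) tD) ext.tinv = Idn D tD"
    using ext.tinv(1) by (intro R.Trm_eqI[of tD]) simp_all
  then show ?thesis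
    using ext.tinv(1) by (simp add: ext.gp_eq cst_def)
qed

end

section \<open>The equivalence\<close>

theorem theorem6p4:
  fixes P :: "('o, 'a, 'p) doctrine"
    and R :: "('u, 'b, 'q) doctrine"
    and X :: 'o
    and \<phi> :: 'p
  assumes "is_primary P"
    and "X \<in> Ob (Base P)"
    and "\<phi> \<in> carrier (Fib P X)"
    and "is_primary R"
  shows "is_equivalence (PD (kleisli_doctrine P X \<phi>) R) (PD_at P X \<phi> R)
           (kleisli_precomp P X \<phi> R)"
proof -
  interpret kleisli P X \<phi> by unfold_locales fact+
  interpret R: primary_doctrine R by unfold_locales fact
  let ?K = "PD P\<^sub>X R" and ?L = "PD_at P X \<phi> R"
  have arrow: "kleisli_1arrow P X \<phi> R K k" if "(K, k) \<in> Ob ?K" for K k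
    using that by unfold_locales (simp add: PD_def)
  have pair: "kleisli_1arrow_pair P X \<phi> R K k K' k'"
    if "(K, k) \<in> Ob ?K" "(K', k') \<in> Ob ?K" for K k K' k'
    using arrow[OF that(1)] arrow[OF that(2)] by (simp add: kleisli_1arrow_pair_def)
  define F0 where "F0 = (\<lambda>(K, k :: 'o \<Rightarrow> 'p \<Rightarrow> 'q). (comp_arrow1 P (K, k) (kleisli_arrow1 P X \<phi>),
      generic_point C (Base R) X K))"
  have F0: "F0 (K, k) = ((kleisli_1arrow.res_func P X \<phi> K, kleisli_1arrow.res_fib P X \<phi> k),
      generic_point C (Base R) X K)" if "(K, k) \<in> Ob ?K" for K k
    using kleisli_1arrow.comp_arrow1_eq[OF arrow[OF that]] by (simp add: F0_def)
  have F0_Ob: "F0 M \<in> Ob ?L" if "M \<in> Ob ?K" for M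
    using that F0 kleisli_1arrow.precomp_in_PD_at[OF arrow] by (cases M) simp
  \<comment> \<open>F_X is the identity on objects, so 2-cells on both sides are families over the
    same index set with the same components. Full faithfulness therefore takes the form of an
    equality of sets.\<close>
  have Hom_eq: "Hom ?K M N = Hom ?L (F0 M) (F0 N)" if "M \<in> Ob ?K" "N \<in> Ob ?K" for M N
  proof -
    obtain K k K' k' where d: "M = (K, k)" "N = (K', k')" by (cases M, cases N)
    interpret kleisli_1arrow_pair P X \<phi> R K k K' k'
      using that by (intro pair) (simp_all add: d)
    show ?thesis
      using is_cell2_restrict is_cell2_extend that
      by (auto simp: d F0 PD_at_simps PD_def)
  qed
  \<comment> \<open>Whiskering with F_X reindexes a family along the identity of
    \<open>Ob C\<close>; extensionality makes the result equal to the family itself.\<close>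
  have precomp: "kleisli_precomp P X \<phi> R = mk_func ?K F0 (\<lambda>M N \<xi>. \<xi>)"
    unfolding kleisli_precomp_def F0_def[symmetric]
  proof (rule mk_func_cong)
    fix M N \<xi> assume "\<xi> \<in> Hom ?K M N"
    then have "\<xi> \<in> extensional (Ob C)"
      using is_cell2_ext[of P\<^sub>X R M N \<xi>] by (simp add: PD_def)
    then show "(\<lambda>A\<in>Ob C. \<xi> (Fob (fst (kleisli_arrow1 P X \<phi>)) A)) = \<xi>"
      by (intro extensionalityI[of _ "Ob C"]) (simp_all add: kleisli_arrow1_eq)
  qed simp
  have fst_F0: "Fob (fst (fst (F0 M))) A = Fob (fst M) A" if "M \<in> Ob ?K" "A \<in> Ob C" for M A
    using that kleisli_1arrow.res_simps(1)[OF arrow] by (cases M) (simp add: F0)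
  have F: "is_functor ?K ?L (kleisli_precomp P X \<phi> R)"
    unfolding precomp
  proof (rule is_functor_mk_func)
    show "category ?K" by (rule category_PD)
    show "category ?L" by (rule category_PD_at) (use assms in simp_all)
    fix M assume M: "M \<in> Ob ?K"
    then show "F0 M \<in> Ob ?L" by (rule F0_Ob)
    show "Idn ?K M = Idn ?L (F0 M)"
      using fst_F0[OF M]
      by (cases "F0 M"; cases M; cases "fst (F0 M)")
        (auto simp: PD_at_simps PD_def id_cell2_def cong: restrict_cong)
  next
    fix M N L f g
    assume "M \<in> Ob ?K" "N \<in> Ob ?K" "L \<in> Ob ?K"
    from fst_F0[OF this(1)] fst_F0[OF this(2)] fst_F0[OF this(3)]
    show "Cmp ?K M N L g f = Cmp ?L (F0 M) (F0 N) (F0 L) g f"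
      by (cases "F0 M"; cases M; cases "fst (F0 M)"; cases "F0 N"; cases N; cases "fst (F0 N)";
          cases "F0 L"; cases L; cases "fst (F0 L)")
        (auto simp: PD_at_simps PD_def vcomp_cell2_def cong: restrict_cong)
  qed (simp add: Hom_eq)
  \<comment> \<open>The choice of s_A depends on G and c alone, so the extension is a function of
    the pointed 1-arrow and can serve as the section on objects.\<close>
  define S where "S = (\<lambda>((G, g), c).
      (kleisli_point.ext_func P X R G c, kleisli_point.ext_fib P X \<phi> R G g c))"
  have S: "S B \<in> Ob ?K \<and> F0 (S B) = B" if "B \<in> Ob ?L" for B
  proof -
    obtain G g c where d: "B = ((G, g), c)" by (metis surj_pair)
    interpret kleisli_point P X \<phi> R G g c
      using that by unfold_locales (simp add: d)
    have "S B \<in> Ob ?K"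
      using is_primary_arrow1_ext by (simp add: S_def d PD_def)
    then show ?thesis
      using F0[of ext_func ext_fib] res_ext_func res_ext_fib generic_point_ext by (simp add: S_def d)
  qed
  show ?thesis
  proof (rule is_equivalence_if_section[OF F, of S])
    fix M N assume "M \<in> Ob ?K" "N \<in> Ob ?K"
    then show "bij_betw (Farr (kleisli_precomp P X \<phi> R) M N) (Hom ?K M N)
        (Hom ?L (Fob (kleisli_precomp P X \<phi> R) M) (Fob (kleisli_precomp P X \<phi> R) N))"
      by (auto simp: precomp Hom_eq bij_betw_def inj_on_def image_iff)
  qed (use S in \<open>simp_all add: precomp\<close>)
qed

end
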